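(* Write $e_n=E_n/n!$. In each identity below, the right-hand side is $b_0+\cfrac{a_1}{b_1+\cfrac{a_2}{b_2+\cdots}}$ with the indicated coefficients ($b_0=0$ unless stated; "$k\ge2$" refers to indices not already specified). (F12) $\sum_{n\ge0}e_{2n+1}x^{2n}$: $a_1=1$, $a_k=-\frac{x^2}{(2k-3)(2k-1)}$ ($k\ge2$), $b_k=1$ ($k\ge1$). (F13) $\sum_{n\ge0}e_{2n+1}x^{n}$: $a_1=1$, $b_1=1-\frac{x}{3}$, $a_k=-\frac{x^2}{(4k-7)(4k-5)^2(4k-3)}$, $b_k=1-\frac{2x}{(4k-5)(4k-1)}$ ($k\ge2$). (F14) $\sum_{n\ge0}e_{2n+3}x^{2n+1}$: $a_1=\frac{x}{3}$, $a_k=-\frac{x^4}{(4k-5)(4k-3)^2(4k-1)}$ ($k\ge2$), $b_k=1-\frac{2x^2}{(4k-3)(4k+1)}$ ($k\ge1$). (F15) $\tan(x)$: $a_1=x$, $b_1=1-\frac{x^2}{3}$, $a_k=-\frac{x^4}{(4k-7)(4k-5)^2(4k-3)}$, $b_k=1-\frac{2x^2}{(4k-5)(4k-1)}$ ($k\ge2$). (F16) $\sum_{n\ge0}e_{n+1}x^n$: $a_1=1$, $b_1=1-\frac{x}{2}$, $a_k=-\frac{x^2}{(4k-6)(4k-2)}$, $b_k=1$ ($k\ge2$). (F17) $\tan(x)+\sec(x)$: $a_1=1$, $b_1=1-x$, $a_2=\frac{x^2}{2}$, $a_k=\frac{x^2}{(4k-6)^2}$ ($k\ge3$), $b_k=1+(-1)^k\frac{(2k-2)x}{(2k-3)(2k-1)}$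 ($k\ge2$). (F18) $\sum_{n\ge0}e_{n+2}x^n$: $a_1=\frac12$, $a_k=\frac{x^2}{(4k-2)^2}$ ($k\ge2$), $b_k=1+(-1)^k\frac{2kx}{(2k-1)(2k+1)}$ ($k\ge1$). (F19) $\sum_{n\ge0}e_{n+3}x^n$: $a_1=\frac13$, $a_j=-\frac{(j-1)^2(j+1)^2x^2}{4j^4(2j-1)(2j+1)}$ ($j\ge2$), $b_j=1+(-1)^j\frac{(2j^2+2j+1)x}{2j^2(j+1)^2}$ ($j\ge1$). (F20) $\sum_{n\ge0}e_{n+4}x^n$: $a_1=\frac{5}{24}$, $a_j=\frac{(j^2+3j+1)(j^2-j-1)(j+2)(j-1)x^2}{4(j^2+j-1)^2(2j+1)^2(j+1)j}$ ($j\ge2$), $b_j=1+\frac{2(-1)^j(j+2)(j+1)^3j\,x}{(j^2+3j+1)(j^2+j-1)(2j+3)(2j+1)}$ ($j\ge1$). (F21) $\sum_{n\ge0}e_{2n+3}x^{2n}$: $a_1=\frac13$, $a_{2k}=-\frac{(2k+1)(k+1)x^2}{(4k-1)(4k+1)(2k-1)k}$ ($k\ge1$), $a_{2k+1}=-\frac{k(2k-1)x^2}{(4k+1)(4k+3)(2k+1)(k+1)}$ ($k\ge1$), $b_k=1$ ($k\ge1$). (F22) $\sum_{n\ge0}e_{2n+3}x^{n}$: $a_1=\frac13$, $a_k=-\frac{x^2}{(4k-5)(4k-3)^2(4k-1)}$ ($k\ge2$), $b_k=1-\frac{2x}{(4k-3)(4k+1)}$ ($k\ge1$). (F23) $\sum_{n\ge0}e_{2n+5}x^{n}$: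 $a_1=\frac{2}{15}$, $a_j=-\frac{(2j+1)(2j-3)(j+1)(j-1)x^2}{(4j+1)(4j-1)^2(4j-3)(2j-1)^2j^2}$ ($j\ge2$), $b_j=1-\frac{(8j^4+8j^3+22j^2+10j+3)x}{(4j+3)(4j-1)(2j+1)(2j-1)(j+1)j}$ ($j\ge1$). (F24) $\sum_{n\ge0}e_{2n+7}x^{n}$: $a_1=\frac{17}{315}$, $a_j=-\frac{(4j^2+10j+3)(4j^2-6j-1)(2j+3)(2j-3)(j+2)(j-1)x^2}{(4j^2+2j-3)^2(4j+3)(4j+1)^2(4j-1)(2j+1)(2j-1)(j+1)j}$ ($j\ge2$), $b_j=1-\frac{2(16j^4+48j^3+164j^2+192j+45)x}{(4j^2+10j+3)(4j^2+2j-3)(4j+5)(4j+1)}$ ($j\ge1$).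
   Context: The Euler numbers $E_n$ are defined by $\tan(x)+\sec(x)=\sum_{n\ge0}E_nx^n/n!$, and $e_n=E_n/n!$; thus $\tan x=\sum_{n\ge0}e_{2n+1}x^{2n+1}$. All identities are in the ring of formal power series in $x$ over $\mathbb{Q}$; a continued fraction denotes the $x$-adic limit of its convergents. *)

theory Defs
  imports "HOL-Computational_Algebra.Formal_Power_Series"
begin

definition fps_sec :: "'a::field_char_0 \<Rightarrow> 'a fps" where
  "fps_sec c = inverse (fps_cos c)"

definition euler_number :: "nat \<Rightarrow> rat" where
  "euler_number n = fact n * fps_nth (fps_tan 1 + fps_sec 1) n"

definition euler_e :: "nat \<Rightarrow> rat" where
  "euler_e n = euler_number n / fact n"

text \<open>
  \<open>cf_tail a b k n\<close> is the finite continued fraction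
  \<open>a\<^sub>k / (b\<^sub>k + a\<^sub>k\<^sub>+\<^sub>1 / (b\<^sub>k\<^sub>+\<^sub>1 + \<dots>))\<close> with \<open>n\<close> partial quotients.
\<close>

primrec cf_tail :: "(nat \<Rightarrow> 'a::field fps) \<Rightarrow> (nat \<Rightarrow> 'a fps) \<Rightarrow> nat \<Rightarrow> nat \<Rightarrow> 'a fps" where
  "cf_tail a b k 0 = 0"
| "cf_tail a b k (Suc n) = a k / (b k + cf_tail a b (Suc k) n)"

definition cf_convergent :: "(nat \<Rightarrow> 'a::field fps) \<Rightarrow> (nat \<Rightarrow> 'a fps) \<Rightarrow> nat \<Rightarrow> 'a fps" where
  "cf_convergent a b n = b 0 + cf_tail a b 1 n"

text \<open>
  Division of formal power series is total in the library and only meaningful if it is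
  exact; hence all denominators that occur in convergents are required to be units. The value
  \<open>a 0\<close> is irrelevant. The limit is taken in the library's metric on formal power series,
  \<open>dist f g = 2\<close> to the power \<open>- subdegree (f - g)\<close>, which induces the \<open>x\<close>-adic topology.
\<close>

definition has_cfrac :: "'a::field fps \<Rightarrow> (nat \<Rightarrow> 'a fps) \<Rightarrow> (nat \<Rightarrow> 'a fps) \<Rightarrow> bool" where
  "has_cfrac f a b \<longleftrightarrow>
     (\<forall>k\<ge>1. \<forall>n. is_unit (b k + cf_tail a b (Suc k) n)) \<and>
     cf_convergent a b \<longlonglongrightarrow> f"

end

theory Submission
  imports Defs
begin

text \<open>
  The series \<open>\<psi>\<^sub>m(y)\<close>, normalised Bessel functions of half-integer order, satisfy
  \<open>\<psi>\<^sub>m = \<psi>\<^sub>m\<^sub>+\<^sub>1 - y \<psi>\<^sub>m\<^sub>+\<^sub>2 / ((2m+1)(2m+3))\<close>, and \<open>cos x = \<psi>\<^sub>0(x\<^sup>2)\<close>, \<open>sin x = x \<psi>\<^sub>1(x\<^sup>2)\<close>. If series \<open>h\<^sub>k\<close> with constant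
  term 1 satisfy \<open>h\<^sub>k = b\<^sub>k\<^sub>+\<^sub>1 h\<^sub>k\<^sub>+\<^sub>1 + a\<^sub>k\<^sub>+\<^sub>2 h\<^sub>k\<^sub>+\<^sub>2\<close>, then the continued fraction with coefficients \<open>a, b\<close> converges
  to \<open>a\<^sub>1 h\<^sub>1 / h\<^sub>0\<close>. For each of the identities such \<open>h\<^sub>k\<close> (the remainders of the convergents, multiplied by the
  denominator of the function and normalised) is a combination of at most four consecutive
  \<open>\<psi>\<^sub>m\<close> with explicit coefficients rational in \<open>k\<close>; the recurrence then reduces to a few identities
  between rational functions of \<open>k\<close>. For the tangent one takes \<open>h\<^sub>0 = cos x\<close>, and for
  \<open>tan x + sec x = (cos (x/2) + sin (x/2)) / (cos (x/2) - sin (x/2))\<close> the denominator of the right-hand side.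
\<close>

unbundle fps_syntax

section \<open>Continued fractions from three-term recurrences\<close>

text \<open>Gives every denominator \<open>b k + cf_tail a b (Suc k) n\<close> with
  \<open>k \<ge> 1\<close> the constant term 1, so that all divisions in the convergents are by
  units and hence exact.\<close>

lemma cf_tail_nth_0:
  assumes a: "\<And>k. k \<ge> 2 \<Longrightarrow> a k $ 0 = 0" and b: "\<And>k. k \<ge> 1 \<Longrightarrow> b k $ 0 = (1::'a::field)"
    and "k \<ge> 2"
  shows "cf_tail a b k n $ 0 = 0"
  using assms(3)
proof (induction n arbitrary: k)
  case (Suc n)
  have "cf_tail a b (Suc k) n $ 0 = 0"
    using Suc by simp
  then show ?case
    using a[of k] b[of k] Suc.prems by (simp add: fps_divide_unit)
qed simp

text \<open>
  The sequence \<open>h\<close> plays the role of a minimal solution: \<open>a k * h k / h (k - 1)\<close> is the value of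
  the tail starting with the \<open>k\<close>-th partial quotient, and the error of the approximating finite
  tails gains a factor \<open>a k\<close>, hence a power of \<open>X\<close>, at each step.
\<close>
lemma has_cfrac_of_recurrence:
  fixes f :: "'a::field fps"
  assumes b0: "b 0 = 0"
    and a: "\<And>k. k \<ge> 2 \<Longrightarrow> a k $ 0 = 0" and b: "\<And>k. k \<ge> 1 \<Longrightarrow> b k $ 0 = 1"
    and h: "\<And>k. h k $ 0 = 1"
    and rec: "\<And>k. h k = b (Suc k) * h (Suc k) + a (Suc (Suc k)) * h (Suc (Suc k))"
    and f: "f * h 0 = a 1 * h 1"
  shows "has_cfrac f a b"
proof -
  have tail_0: "cf_tail a b k n $ 0 = 0" if "k \<ge> 2" for k n
    using cf_tail_nth_0[of a b, OF a b that] .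
  have unit: "(b k + cf_tail a b (Suc k) n) $ 0 = 1" if "k \<ge> 1" for k n
    using that b tail_0[of "Suc k" n] by simp
  have step: "cf_tail a b k (Suc n) * h (k - 1) - a k * h k =
      cf_tail a b k (Suc n) * - (cf_tail a b (Suc k) n * h k - a (Suc k) * h (Suc k))" if "k \<ge> 1" for k n
  proof -
    define m where "m = k - 1"
    have m: "k = Suc m"
      using that by (simp add: m_def)
    define T where "T = cf_tail a b (Suc m) (Suc n)"
    have "a (Suc m) = T * (b (Suc m) + cf_tail a b (Suc (Suc m)) n)"
      using unit[of "Suc m" n] by (simp add: T_def)
    then show ?thesis
      unfolding m T_def[symmetric] by (simp add: rec[of m] algebra_simps)
  qed
  have dvd: "fps_X ^ n dvd cf_tail a b k n * h (k - 1) - a k * h k" if "k \<ge> 2" for k n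
    using that
  proof (induction n arbitrary: k)
    case (Suc n)
    have "fps_X dvd cf_tail a b k (Suc n)"
      using tail_0[OF Suc.prems, of "Suc n"] fps_dvd_iff[of "fps_X" "cf_tail a b k (Suc n)"]
      by (cases "cf_tail a b k (Suc n) = 0") (auto simp: subdegree_eq_0_iff Suc_le_eq simp del: cf_tail.simps)
    moreover have "fps_X ^ n dvd cf_tail a b (Suc k) n * h k - a (Suc k) * h (Suc k)"
      using Suc.IH[of "Suc k"] Suc.prems by simp
    moreover have "k \<ge> 1"
      using Suc.prems by simp
    ultimately show ?case
      unfolding step[OF \<open>k \<ge> 1\<close>] power_Suc by (intro mult_dvd_mono) (simp_all only: dvd_minus_iff)
  qed simp
  \<comment> \<open>\<open>a 1\<close> may have a nonzero constant term, so the first step gains no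
    power of \<open>fps_X\<close>: with n partial quotients the error is divisible by
    \<open>fps_X ^ (n - 1)\<close>, and coefficient m is settled once n - 1 > m.\<close>
  have "cf_tail a b 1 n $ m = f $ m" if "n \<ge> m + 2" for n m
  proof -
    define n' where "n' = n - 1"
    have n: "n = Suc n'"
      using that by (simp add: n'_def)
    have "fps_X ^ n' dvd cf_tail a b 2 n' * h 1 - a 2 * h 2"
      using dvd[of 2 n'] by simp
    then have "fps_X ^ n' dvd cf_tail a b 1 n * h 0 - a 1 * h 1"
      using step[OF le_refl, of n'] dvd_mult[of "fps_X ^ n'" _ "- cf_tail a b 1 n"]
      by (simp only: n numeral_2_eq_2 One_nat_def diff_Suc_1 mult_minus_left mult_minus_right
          diff_self_eq_0 le_refl)
    also have "cf_tail a b 1 n * h 0 - a 1 * h 1 = (cf_tail a b 1 n - f) * h 0"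
      using f by (simp add: algebra_simps)
    finally have "fps_X ^ n' dvd (cf_tail a b 1 n - f) * h 0 * inverse (h 0)"
      by (rule dvd_mult2)
    then have "fps_X ^ n' dvd cf_tail a b 1 n - f"
      using h[of 0] by (simp add: mult.assoc inverse_mult_eq_1' del: cf_tail.simps)
    then obtain g where g: "cf_tail a b 1 n - f = fps_X ^ n' * g" ..
    have "(cf_tail a b 1 n - f) $ m = 0"
      unfolding g fps_X_power_mult_nth using that n by simp
    then show ?thesis
      by simp
  qed
  then have "cf_convergent a b \<longlonglongrightarrow> f"
    unfolding tendsto_fps_iff cf_convergent_def b0 by (auto simp: eventually_at_top_linorder)
  then show ?thesis
    using unit unfolding has_cfrac_def by simp
qed

section \<open>Half-integer Bessel series and their contiguous relation\<close>

text \<open>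
  This is \<open>\<^sub>0F\<^sub>1(; m + 1/2; - x/4)\<close>; the factor \<open>2\<^sup>n\<close> turns the Pochhammer symbol of the half-integer
  into a product of odd numbers.
\<close>
definition bessel_half :: "nat \<Rightarrow> 'a::field_char_0 fps" where
  "bessel_half m = Abs_fps (\<lambda>n. (- 1) ^ n / (2 ^ n * fact n * (\<Prod>i<n. of_nat (2 * (m + i) + 1))))"

lemma prod_odd_neq_0: "(\<Prod>i<n. of_nat (2 * (m + i) + 1)) \<noteq> (0::'a::field_char_0)"
  unfolding prod_zero_iff[OF finite_lessThan] of_nat_eq_0_iff by simp

lemma bessel_half_nth_0 [simp]: "bessel_half m $ 0 = 1"
  by (simp add: bessel_half_def)

text \<open>Constant terms agree. At n = l + 1, cancelling the odd factors common to the three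
  coefficients leaves the identity (2(m+l+1)+1) - (2m+1) = 2(l+1).\<close>

lemma bessel_half_rec:
  "bessel_half m = bessel_half (Suc m) -
     fps_const (1 / (of_nat (2 * m + 1) * of_nat (2 * m + 3))) * (fps_X * bessel_half (Suc (Suc m)))"
  (is "_ = ?r")
proof (rule fps_ext)
  fix n
  show "bessel_half m $ n = ?r $ n"
  proof (cases n)
    case (Suc l)
    define P where "P = (\<lambda>m n. \<Prod>i<n. of_nat (2 * (m + i) + 1) :: 'a)"
    define A where "A = P (Suc m) l"
    have shift: "P m (Suc l) = of_nat (2 * m + 1) * P (Suc m) l" for m l
      by (simp add: P_def prod.lessThan_Suc_shift del: prod.lessThan_Suc of_nat_Suc)
    have last: "P m (Suc l) = P m l * of_nat (2 * (m + l) + 1)" for m l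
      by (simp add: P_def)
    have A0: "A \<noteq> 0"
      unfolding A_def P_def by (rule prod_odd_neq_0)
    have nz: "of_nat (2 * m + 1) \<noteq> (0::'a)" "of_nat (2 * m + 3) \<noteq> (0::'a)"
      "of_nat (2 * (Suc m + l) + 1) \<noteq> (0::'a)" "of_nat (Suc l) \<noteq> (0::'a)"
      unfolding of_nat_eq_0_iff by auto
    have 1: "P m (Suc l) = of_nat (2 * m + 1) * A" "P (Suc m) (Suc l) = A * of_nat (2 * (Suc m + l) + 1)"
      "P (Suc (Suc m)) l = A * of_nat (2 * (Suc m + l) + 1) / of_nat (2 * m + 3)"
      using shift[of m l] last[of "Suc m" l] shift[of "Suc m" l] nz
      by (simp_all add: A_def field_simps)
    \<comment> \<open>The odd factors left over beside \<open>A\<close> become atoms, so that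
      clearing denominators does not expand them; \<open>w = u + 2 * of_nat (Suc l)\<close> is the
      one relation used between them.\<close>
    define u v w :: 'a where "u = of_nat (2 * m + 1)" and "v = of_nat (2 * m + 3)" and
      "w = of_nat (2 * (Suc m + l) + 1)"
    have uvw: "u \<noteq> 0" "v \<noteq> 0" "w \<noteq> 0" "w = u + 2 * of_nat (Suc l)"
      using nz by (simp_all add: u_def v_def w_def)
    define F :: 'a where "F = 2 ^ l * fact l"
    have F0: "F \<noteq> 0" by (simp add: F_def)
    have "(- 1) ^ Suc l / (2 * of_nat (Suc l) * F * (u * A)) =
        (- 1) ^ Suc l / (2 * of_nat (Suc l) * F * (A * w)) - 1 / (u * v) * ((- 1) ^ l / (F * (A * w / v)))"
      using uvw(1,2,3) A0 nz(4) F0 by (simp add: divide_simps del: of_nat_Suc) (simp add: uvw(4) algebra_simps)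
    moreover have "bessel_half m $ n = (- 1) ^ n / (2 ^ n * fact n * P m n)" for m n
      by (simp add: bessel_half_def P_def)
    moreover have "2 ^ Suc l * fact (Suc l) = 2 * of_nat (Suc l) * F"
      by (simp add: F_def)
    ultimately show ?thesis
      unfolding Suc fps_sub_nth fps_mult_left_const_nth fps_X_mult_nth
      by (simp only: 1 u_def v_def w_def F_def[symmetric] diff_Suc_1 nat.distinct if_False)
  qed simp
qed

text \<open>The even factors making up \<open>2 ^ n * fact n\<close> interleave with the odd ones to
  a full factorial. The summand \<open>0\<close> is kept so that the left-hand side matches the
  unfolded \<open>bessel_half 0\<close>.\<close>

lemma prod_odd_0: "2 ^ n * fact n * (\<Prod>i<n. of_nat (2 * (0 + i) + 1)) = (fact (2 * n) :: 'a::field_char_0)"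
proof (induction n)
  case (Suc n)
  define P where "P = (\<Prod>i<n. of_nat (2 * (0 + i) + 1) :: 'a)"
  have "2 ^ Suc n * fact (Suc n) * (P * of_nat (2 * n + 1)) =
      of_nat (2 * n + 2) * of_nat (2 * n + 1) * (2 ^ n * fact n * P)"
    by (simp add: algebra_simps)
  also have "2 ^ n * fact n * P = fact (2 * n)"
    using Suc.IH by (simp only: P_def)
  finally show ?case
    by (simp add: P_def algebra_simps)
qed simp

lemma prod_odd_1: "2 ^ n * fact n * (\<Prod>i<n. of_nat (2 * (1 + i) + 1)) = (fact (2 * n + 1) :: 'a::field_char_0)"
proof (induction n)
  case (Suc n)
  define P where "P = (\<Prod>i<n. of_nat (2 * (1 + i) + 1) :: 'a)"
  have "2 ^ Suc n * fact (Suc n) * (P * of_nat (2 * (1 + n) + 1)) =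
      of_nat (2 * n + 3) * of_nat (2 * n + 2) * (2 ^ n * fact n * P)"
    by (simp add: algebra_simps)
  also have "2 ^ n * fact n * P = fact (2 * n + 1)"
    using Suc.IH by (simp only: P_def)
  finally show ?case
    by (simp add: P_def algebra_simps)
qed simp

section \<open>Cosine and sine as Bessel series in the squared variable\<close>

lemma fps_compose_const_X_power2_nth:
  fixes f :: "'a::field_char_0 fps"
  shows "(f oo (fps_const c * fps_X ^ 2)) $ n = (if even n then f $ (n div 2) * c ^ (n div 2) else 0)"
proof -
  have "(f oo (fps_const c * fps_X ^ 2)) $ n = (\<Sum>i=0..n. if n = 2 * i then f $ i * c ^ i else 0)"
    unfolding fps_compose_nth
    by (intro sum.cong) (auto simp: power_mult_distrib fps_const_power power_mult[symmetric])
  also have "\<dots> = (if even n then f $ (n div 2) * c ^ (n div 2) else 0)"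
    by (cases "even n") (auto elim!: evenE intro!: sum.neutral)
  finally show ?thesis .
qed

lemma bessel_half_0_nth: "bessel_half 0 $ n = (- 1) ^ n / fact (2 * n)"
  unfolding bessel_half_def fps_nth_Abs_fps prod_odd_0 ..

lemma bessel_half_1_nth: "bessel_half 1 $ n = (- 1) ^ n / fact (2 * n + 1)"
  unfolding bessel_half_def fps_nth_Abs_fps prod_odd_1 ..

lemma fps_cos_bessel: "fps_cos c = bessel_half 0 oo (fps_const (c ^ 2) * fps_X ^ 2)"
  by (rule fps_ext)
    (auto simp: fps_compose_const_X_power2_nth fps_cos_def bessel_half_0_nth elim!: evenE simp flip: power_mult)

lemma fps_sin_bessel: "fps_sin c = fps_const c * (fps_X * (bessel_half 1 oo (fps_const (c ^ 2) * fps_X ^ 2)))"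
proof (rule fps_ext)
  fix n
  show "fps_sin c $ n = (fps_const c * (fps_X * (bessel_half 1 oo (fps_const (c ^ 2) * fps_X ^ 2)))) $ n"
    unfolding fps_mult_left_const_nth fps_X_mult_nth fps_compose_const_X_power2_nth bessel_half_1_nth
    by (cases n) (auto simp: fps_sin_def power_mult elim!: evenE simp del: fact_Suc)
qed

section \<open>Combinations of contiguous Bessel series\<close>

text \<open>Needed at the arguments x^2/4, x and x^2. The vanishing constant term makes composition
  compatible with products.\<close>

lemma bessel_half_compose_rec:
  assumes "y $ 0 = 0"
  shows "bessel_half m oo y = (bessel_half (Suc m) oo y) -
     fps_const (1 / (of_nat (2 * m + 1) * of_nat (2 * m + 3))) * (y * (bessel_half (Suc (Suc m)) oo y))"
  by (subst bessel_half_rec) (simp add: assms fps_compose_sub_distrib fps_compose_mult_distrib)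

text \<open>The leading coefficient is fixed to 1 so that remainders have constant term 1. Pairing
  x^i with an index raised by i suits both uses: contiguous relations carrying x^2 and those
  carrying x.\<close>

definition lincomb :: "(nat \<Rightarrow> 'a::field fps) \<Rightarrow> 'a fps \<Rightarrow> 'a \<Rightarrow> 'a \<Rightarrow> 'a \<Rightarrow> nat \<Rightarrow> 'a fps" where
  "lincomb y x p q r m = y m + fps_const p * (x * y (Suc m)) + fps_const q * (x ^ 2 * y (Suc (Suc m))) +
     fps_const r * (x ^ 3 * y (Suc (Suc (Suc m))))"

lemma lincomb_nth_0:
  assumes "x $ 0 = 0" "y m $ 0 = 1"
  shows "lincomb y x p q r m $ 0 = 1"
  using assms by (simp add: lincomb_def power2_eq_square power3_eq_cube)

text \<open>
  In the three identities below, the difference of both sides is written as a combination of the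
  contiguous relations and of the assumptions on the coefficients, found by eliminating the series of
  lowest index first.
\<close>
lemma shift_1_identity:
  fixes x :: "'r::comm_ring_1"
  assumes y: "y0 = y1 - c0 * (x ^ 2 * y2)" "y1 = y2 - c1 * (x ^ 2 * y3)"
      "y2 = y3 - c2 * (x ^ 2 * y4)" "y3 = y4 - c3 * (x ^ 2 * y5)"
    and 1: "p1 = b + q1"
    and 2: "p2 = c0 + b * q1 + a + q2"
    and 3: "p3 = b * q2 + a * r1 + c1 * q1 + q3"
    and 4: "b * q3 + a * r2 + c2 * q2 = 0"
    and 5: "a * r3 + c3 * q3 = 0"
  shows "y0 + p1 * (x * y1) + p2 * (x ^ 2 * y2) + p3 * (x ^ 3 * y3) =
    (1 + b * x) * (y1 + q1 * (x * y2) + q2 * (x ^ 2 * y3) + q3 * (x ^ 3 * y4)) +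
    a * x ^ 2 * (y2 + r1 * (x * y3) + r2 * (x ^ 2 * y4) + r3 * (x ^ 3 * y5))" (is "?l = ?r")
proof -
  have "?l - ?r =
      (y0 - (y1 - c0 * (x ^ 2 * y2))) + x * q1 * (y1 - (y2 - c1 * (x ^ 2 * y3))) +
      x ^ 2 * q2 * (y2 - (y3 - c2 * (x ^ 2 * y4))) + x ^ 3 * q3 * (y3 - (y4 - c3 * (x ^ 2 * y5))) +
      x * (p1 - (b + q1)) * y1 + x ^ 2 * (p2 - (c0 + b * q1 + a + q2)) * y2 +
      x ^ 3 * (p3 - (b * q2 + a * r1 + c1 * q1 + q3)) * y3 -
      x ^ 4 * (b * q3 + a * r2 + c2 * q2) * y4 - x ^ 5 * (a * r3 + c3 * q3) * y5"
    by (simp add: algebra_simps eval_nat_numeral)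
  also have "\<dots> = 0"
    unfolding 4 5 using y 1 2 3 by simp
  finally show ?thesis
    by simp
qed

lemma shift_2_identity:
  fixes x :: "'r::comm_ring_1"
  assumes y: "y0 = y1 - c0 * (x * y2)" "y1 = y2 - c1 * (x * y3)"
      "y2 = y3 - c2 * (x * y4)" "y3 = y4 - c3 * (x * y5)" "y4 = y5 - c4 * (x * y6)"
    and 1: "p1 = c0 + b + c1 + q1"
    and 2: "p2 = p1 * c1 + q1 * b + q2 + a + (c1 + q1) * c2"
    and 3: "p2 * c2 + b * q2 + a * r1 + (q2 + a + (c1 + q1) * c2) * c3 = 0"
    and 4: "a * r2 = (p2 * c2 + b * q2) * c4"
  shows "y0 + p1 * (x * y1) + p2 * (x ^ 2 * y2) =
    (1 + b * x) * (y2 + q1 * (x * y3) + q2 * (x ^ 2 * y4)) +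
    a * x ^ 2 * (y4 + r1 * (x * y5) + r2 * (x ^ 2 * y6))" (is "?l = ?r")
proof -
  define w where "w = p2 - p1 * c1 - q1 * b"
  define s where "s = - (p2 * c2 + b * q2)"
  have "?l - ?r =
      (y0 - (y1 - c0 * (x * y2))) + (1 + p1 * x) * (y1 - (y2 - c1 * (x * y3))) +
      ((p1 - c0 - b) * x + p2 * x ^ 2) * (y2 - (y3 - c2 * (x * y4))) +
      w * x ^ 2 * (y3 - (y4 - c3 * (x * y5))) + s * x ^ 3 * (y4 - (y5 - c4 * (x * y6))) +
      x * (p1 - (c0 + b + c1 + q1)) * y3 + x ^ 2 * (w - (q2 + a + (p1 - c0 - b) * c2)) * y4 +
      x ^ 3 * (s - a * r1 - w * c3) * y5 - x ^ 4 * (a * r2 + s * c4) * y6"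
    unfolding w_def s_def by (simp add: algebra_simps eval_nat_numeral)
  also have "w - (q2 + a + (p1 - c0 - b) * c2) = 0"
    unfolding w_def using 1 2 by (simp add: algebra_simps)
  also have "s - a * r1 - w * c3 = - (p2 * c2 + b * q2 + a * r1 + (q2 + a + (c1 + q1) * c2) * c3)"
    unfolding s_def w_def 2 by (simp add: algebra_simps)
  also have "p2 * c2 + b * q2 + a * r1 + (q2 + a + (c1 + q1) * c2) * c3 = 0"
    by (rule 3)
  also have "a * r2 + s * c4 = 0"
    unfolding s_def using 4 by (simp add: algebra_simps)
  finally have "?l - ?r = 0"
    using y 1 by (simp only: diff_self mult_zero_left mult_zero_right add_0_left diff_zero minus_zero)
  then show ?thesis
    by simp
qed

lemma shift_1_short_identity:
  fixes x :: "'r::comm_ring_1"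
  assumes y: "y1 = y2 - c0 * (x * y3)" "y2 = y3 - c1 * (x * y4)"
    and 1: "p = c0 + q + a"
    and 2: "p * c1 + a * r = 0"
  shows "y1 + p * (x * y2) = y2 + q * (x * y3) + a * x * (y3 + r * (x * y4))"
proof -
  have "y1 + p * (x * y2) - (y2 + q * (x * y3) + a * x * (y3 + r * (x * y4))) =
      (y1 - (y2 - c0 * (x * y3))) + p * x * (y2 - (y3 - c1 * (x * y4))) +
      x * (p - (c0 + q + a)) * y3 - x ^ 2 * (p * c1 + a * r) * y4"
    by (simp add: algebra_simps eval_nat_numeral)
  also have "\<dots> = 0"
    unfolding 2 using y 1 by simp
  finally show ?thesis
    by simp
qed

text \<open>Assumptions \<open>1\<close> to \<open>5\<close> compare the coefficients of x^1 to x^5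
  in \<open>shift_1_identity\<close>. The sign (-1)^k sits at the odd powers of x and cancels
  because its square is 1; what remains are identities in a field element t \<ge> 0, suited to
  rational function arithmetic.\<close>

lemma lincomb_alternating_rec:
  fixes y :: "nat \<Rightarrow> 'a::linordered_field fps" and p q r \<alpha> \<beta> c :: "'a \<Rightarrow> 'a"
  assumes y: "\<And>j. y j = y (Suc j) - fps_const (c (of_nat j)) * (x ^ 2 * y (Suc (Suc j)))"
    and 1: "\<And>t. t \<ge> 0 \<Longrightarrow> p t = \<beta> t - p (t + 1)"
    and 2: "\<And>t. t \<ge> 0 \<Longrightarrow> q t = c t - \<beta> t * p (t + 1) + \<alpha> t + q (t + 1)"
    and 3: "\<And>t. t \<ge> 0 \<Longrightarrow> r t = \<beta> t * q (t + 1) + \<alpha> t * p (t + 2) - c (t + 1) * p (t + 1) - r (t + 1)"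
    and 4: "\<And>t. t \<ge> 0 \<Longrightarrow> \<beta> t * r (t + 1) = \<alpha> t * q (t + 2) + c (t + 2) * q (t + 1)"
    and 5: "\<And>t. t \<ge> 0 \<Longrightarrow> \<alpha> t * r (t + 2) = c (t + 3) * r (t + 1)"
  defines "h \<equiv> \<lambda>k. lincomb y x ((- 1) ^ k * p (of_nat k)) (q (of_nat k)) ((- 1) ^ k * r (of_nat k)) k"
  shows "h k = (1 + fps_const ((- 1) ^ k * \<beta> (of_nat k)) * x) * h (Suc k) +
    fps_const (\<alpha> (of_nat k)) * x ^ 2 * h (Suc (Suc k))"
proof -
  define t :: 'a where "t = of_nat k"
  define e :: 'a where "e = (- 1) ^ k"
  have t: "t \<ge> 0"
    by (simp add: t_def)
  have e: "e * (e * z) = z" for z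
    by (cases "even k") (simp_all add: e_def)
  have of_nat: "of_nat (Suc k) = t + 1" "of_nat (Suc (Suc k)) = t + 2" "of_nat (Suc (Suc (Suc k))) = t + 3"
    by (simp_all add: t_def)
  note yk = y[of k] y[of "Suc k"] y[of "Suc (Suc k)"] y[of "Suc (Suc (Suc k))"]
  have "lincomb y x (e * p t) (q t) (e * r t) k =
    (1 + fps_const (e * \<beta> t) * x) * lincomb y x (- e * p (t + 1)) (q (t + 1)) (- e * r (t + 1)) (Suc k) +
    fps_const (\<alpha> t) * x ^ 2 * lincomb y x (e * p (t + 2)) (q (t + 2)) (e * r (t + 2)) (Suc (Suc k))"
    unfolding lincomb_def
  proof (rule shift_1_identity[OF yk[unfolded of_nat t_def[symmetric]]])
    show "fps_const (e * p t) = fps_const (e * \<beta> t) + fps_const (- e * p (t + 1))"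
      unfolding 1[OF t] by (simp add: algebra_simps)
    show "fps_const (q t) = fps_const (c t) + fps_const (e * \<beta> t) * fps_const (- e * p (t + 1)) +
        fps_const (\<alpha> t) + fps_const (q (t + 1))"
      unfolding 2[OF t] by (simp add: algebra_simps e)
    show "fps_const (e * r t) = fps_const (e * \<beta> t) * fps_const (q (t + 1)) +
        fps_const (\<alpha> t) * fps_const (e * p (t + 2)) + fps_const (c (t + 1)) * fps_const (- e * p (t + 1)) +
        fps_const (- e * r (t + 1))"
      unfolding 3[OF t] by (simp add: algebra_simps)
    show "fps_const (e * \<beta> t) * fps_const (- e * r (t + 1)) + fps_const (\<alpha> t) * fps_const (q (t + 2)) +
        fps_const (c (t + 2)) * fps_const (q (t + 1)) = 0"
      using 4[OF t] by (simp add: algebra_simps e)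
    show "fps_const (\<alpha> t) * fps_const (e * r (t + 2)) + fps_const (c (t + 3)) * fps_const (- e * r (t + 1)) = 0"
      using 5[OF t] by (simp add: algebra_simps)
  qed
  then show ?thesis
    unfolding h_def power_Suc of_nat e_def t_def by simp
qed

text \<open>Here the contiguous relation carries x instead of x^2, so a partial numerator of order
  x^2 corresponds to raising the Bessel index by 2.\<close>

lemma lincomb_step_2_rec:
  fixes y :: "nat \<Rightarrow> 'a::linordered_field fps" and p q \<alpha> \<beta> c :: "'a \<Rightarrow> 'a"
  assumes y: "\<And>j. y j = y (Suc j) - fps_const (c (of_nat j)) * (x * y (Suc (Suc j)))"
    and 1: "\<And>t. t \<ge> 0 \<Longrightarrow> p t = c (2 * t + s) + \<beta> t + c (2 * t + s + 1) + p (t + 1)"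
    and 2: "\<And>t. t \<ge> 0 \<Longrightarrow> q t = p t * c (2 * t + s + 1) + p (t + 1) * \<beta> t + q (t + 1) + \<alpha> t +
        (c (2 * t + s + 1) + p (t + 1)) * c (2 * t + s + 2)"
    and 3: "\<And>t. t \<ge> 0 \<Longrightarrow> q t * c (2 * t + s + 2) + \<beta> t * q (t + 1) + \<alpha> t * p (t + 2) +
        (q (t + 1) + \<alpha> t + (c (2 * t + s + 1) + p (t + 1)) * c (2 * t + s + 2)) * c (2 * t + s + 3) = 0"
    and 4: "\<And>t. t \<ge> 0 \<Longrightarrow> \<alpha> t * q (t + 2) = (q t * c (2 * t + s + 2) + \<beta> t * q (t + 1)) * c (2 * t + s + 4)"
    and s: "s = of_nat m"
  defines "h \<equiv> \<lambda>k. lincomb y x (p (of_nat k)) (q (of_nat k)) 0 (2 * k + m)"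
  shows "h k = (1 + fps_const (\<beta> (of_nat k)) * x) * h (Suc k) + fps_const (\<alpha> (of_nat k)) * x ^ 2 * h (Suc (Suc k))"
proof -
  define t :: 'a where "t = of_nat k"
  define j where "j = 2 * k + m"
  have t: "t \<ge> 0"
    by (simp add: t_def)
  have of_nat: "of_nat j = 2 * t + s" "of_nat (Suc j) = 2 * t + s + 1" "of_nat (Suc (Suc j)) = 2 * t + s + 2"
    "of_nat (Suc (Suc (Suc j))) = 2 * t + s + 3" "of_nat (Suc (Suc (Suc (Suc j)))) = 2 * t + s + 4"
    "of_nat (Suc k) = t + 1" "of_nat (Suc (Suc k)) = t + 2"
    by (simp_all add: t_def j_def s)
  note yj = y[of j] y[of "Suc j"] y[of "Suc (Suc j)"] y[of "Suc (Suc (Suc j))"] y[of "Suc (Suc (Suc (Suc j)))"]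
  have "y j + fps_const (p t) * (x * y (Suc j)) + fps_const (q t) * (x ^ 2 * y (Suc (Suc j))) =
      (1 + fps_const (\<beta> t) * x) * (y (Suc (Suc j)) + fps_const (p (t + 1)) * (x * y (Suc (Suc (Suc j)))) +
        fps_const (q (t + 1)) * (x ^ 2 * y (Suc (Suc (Suc (Suc j)))))) +
      fps_const (\<alpha> t) * x ^ 2 * (y (Suc (Suc (Suc (Suc j)))) +
        fps_const (p (t + 2)) * (x * y (Suc (Suc (Suc (Suc (Suc j)))))) +
        fps_const (q (t + 2)) * (x ^ 2 * y (Suc (Suc (Suc (Suc (Suc (Suc j))))))))"
    by (rule shift_2_identity[OF yj[unfolded of_nat]])
      (unfold fps_const_mult fps_const_add fps_const_eq_0_iff,
       use 1[OF t] 2[OF t] 3[OF t] 4[OF t] in simp_all)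
  moreover have "2 * Suc k + m = Suc (Suc j)" "2 * Suc (Suc k) + m = Suc (Suc (Suc (Suc j)))"
    by (simp_all add: j_def)
  ultimately show ?thesis
    unfolding h_def lincomb_def of_nat j_def[symmetric] t_def[symmetric] by simp
qed

text \<open>The case of partial denominators 1. The coefficients are functions of the natural number
  k, since in the application they depend on its parity.\<close>

lemma lincomb_step_1_rec:
  fixes y :: "nat \<Rightarrow> 'a::field fps" and p \<alpha> :: "nat \<Rightarrow> 'a"
  assumes y: "\<And>j. y j = y (Suc j) - fps_const (c j) * (x * y (Suc (Suc j)))"
    and 1: "p k = c (Suc k) + p (Suc k) + \<alpha> k"
    and 2: "p k * c (Suc (Suc k)) + \<alpha> k * p (Suc (Suc k)) = 0"
  defines "h \<equiv> \<lambda>k. lincomb y x (p k) 0 0 (Suc k)"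
  shows "h k = h (Suc k) + fps_const (\<alpha> k) * x * h (Suc (Suc k))"
proof -
  have "y (Suc k) + fps_const (p k) * (x * y (Suc (Suc k))) =
      y (Suc (Suc k)) + fps_const (p (Suc k)) * (x * y (Suc (Suc (Suc k)))) +
      fps_const (\<alpha> k) * x * (y (Suc (Suc (Suc k))) + fps_const (p (Suc (Suc k))) * (x * y (Suc (Suc (Suc (Suc k))))))"
    by (rule shift_1_short_identity[OF y[of "Suc k"] y[of "Suc (Suc k)"]])
      (unfold fps_const_mult fps_const_add fps_const_eq_0_iff, use 1 2 in simp_all)
  then show ?thesis
    unfolding h_def lincomb_def by simp
qed

section \<open>Shifts of the tangent plus secant series\<close>

text \<open>The argument x^2/4 belongs to the half angle: cos(x/2) is \<open>half_bessel 0\<close>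
  and sin(x/2) is x/2 times \<open>half_bessel 1\<close>.\<close>

definition half_bessel :: "nat \<Rightarrow> rat fps" where
  "half_bessel m = bessel_half m oo (fps_const (1 / 4) * fps_X ^ 2)"

lemma half_bessel_nth_0 [simp]: "half_bessel m $ 0 = 1"
  by (simp add: half_bessel_def)

definition half_bessel_coeff :: "rat \<Rightarrow> rat" where
  "half_bessel_coeff t = 1 / (4 * (2 * t + 1) * (2 * t + 3))"

lemma half_bessel_rec:
  "half_bessel m = half_bessel (Suc m) -
     fps_const (half_bessel_coeff (of_nat m)) * (fps_X ^ 2 * half_bessel (Suc (Suc m)))"
proof -
  have "fps_const (1 / (of_nat (2 * m + 1) * of_nat (2 * m + 3))) * (fps_const (1 / 4) * fps_X ^ 2 * z) =
      fps_const (half_bessel_coeff (of_nat m)) * (fps_X ^ 2 * z)" for z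
    unfolding mult.assoc[symmetric] fps_const_mult half_bessel_coeff_def by (simp add: algebra_simps)
  then show ?thesis
    unfolding half_bessel_def by (subst bessel_half_compose_rec) simp_all
qed

text \<open>Absorbs the index shifts: at 0, \<alpha> and \<beta> describe \<open>a 2\<close> and
  \<open>b 1\<close>. The assumption on \<open>f\<close> relates the remainders for k = 0 and k = 1,
  whence the signs of \<open>p 1\<close> and \<open>r 1\<close>.\<close>

lemma has_cfrac_alternating:
  fixes p q r \<alpha> \<beta> :: "rat \<Rightarrow> rat"
  assumes b0: "b 0 = 0"
    and a: "\<And>k. a (Suc (Suc k)) = fps_const (\<alpha> (of_nat k)) * fps_X ^ 2"
    and b: "\<And>k. b (Suc k) = 1 + fps_const ((- 1) ^ k * \<beta> (of_nat k)) * fps_X"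
    and eqs: "\<And>t. t \<ge> 0 \<Longrightarrow> p t = \<beta> t - p (t + 1)"
      "\<And>t. t \<ge> 0 \<Longrightarrow> q t = half_bessel_coeff t - \<beta> t * p (t + 1) + \<alpha> t + q (t + 1)"
      "\<And>t. t \<ge> 0 \<Longrightarrow> r t = \<beta> t * q (t + 1) + \<alpha> t * p (t + 2) - half_bessel_coeff (t + 1) * p (t + 1) - r (t + 1)"
      "\<And>t. t \<ge> 0 \<Longrightarrow> \<beta> t * r (t + 1) = \<alpha> t * q (t + 2) + half_bessel_coeff (t + 2) * q (t + 1)"
      "\<And>t. t \<ge> 0 \<Longrightarrow> \<alpha> t * r (t + 2) = half_bessel_coeff (t + 3) * r (t + 1)"
    and f: "f * lincomb half_bessel fps_X (p 0) (q 0) (r 0) 0 =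
      a 1 * lincomb half_bessel fps_X (- p 1) (q 1) (- r 1) 1"
  shows "has_cfrac f a b"
proof -
  define h where "h k = lincomb half_bessel fps_X ((- 1) ^ k * p (of_nat k)) (q (of_nat k)) ((- 1) ^ k * r (of_nat k)) k" for k
  show ?thesis
  proof (rule has_cfrac_of_recurrence[where a = a and b = b and f = f and h = h])
  show "a k $ 0 = 0" if "k \<ge> 2" for k
  proof -
    have k: "k = Suc (Suc (k - 2))"
      using that by simp
    show ?thesis
      by (subst k, subst a) (simp add: power2_eq_square)
  qed
  show "b k $ 0 = 1" if "k \<ge> 1" for k
    using b[of "k - 1"] that by simp
    show "h k = b (Suc k) * h (Suc k) + a (Suc (Suc k)) * h (Suc (Suc k))" for k
      unfolding a b h_def by (rule lincomb_alternating_rec[OF half_bessel_rec eqs])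
  qed (use b0 f in \<open>simp_all add: h_def lincomb_nth_0\<close>)
qed

text \<open>Matching numerators and denominators separately turns the comparison of a prescribed
  coefficient with its index-shifted form into polynomial identities, without nonvanishing
  conditions.\<close>

lemma fps_const_fraction_cong:
  "x = x' \<Longrightarrow> y = y' \<Longrightarrow> fps_const (x / y) * z = fps_const (x' / y') * z"
  "x = x' \<Longrightarrow> y = y' \<Longrightarrow> 1 + fps_const (x / y) * z = 1 + fps_const (x' / y') * z"
  "x = x' \<Longrightarrow> y = y' \<Longrightarrow> 1 - fps_const (x / y) * z = 1 - fps_const (x' / y') * z"
  by simp_all

text \<open>
  The function \<open>l\<close>, and similar ones below, hide the linear and quadratic denominators from the simplifier,
  which would otherwise distribute numerals over them and no longer recognise them as nonzero.
\<close>
lemma shift_2_coeff_eqs: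
  fixes l P A B :: "rat \<Rightarrow> rat"
  assumes l: "\<And>t. l t = 2 * t + 1"
    and P: "\<And>t. P t = - 1 / (2 * l t)"
    and A: "\<And>t. A t = 1 / (4 * l (t + 1) ^ 2)"
    and B: "\<And>t. B t = - (2 * (t + 1)) / (l t * l (t + 1))"
    and t: "t \<ge> 0"
  shows "P t = B t - P (t + 1)"
    and "0 = half_bessel_coeff t - B t * P (t + 1) + A t + 0"
    and "0 = B t * 0 + A t * P (t + 2) - half_bessel_coeff (t + 1) * P (t + 1) - 0"
proof -
  have nz: "l (t + s) \<noteq> 0" if "s \<ge> 0" for s
    using t that by (simp add: l)
  have nz0: "l t \<noteq> 0"
    using nz[of 0] by simp
  have c: "half_bessel_coeff t = 1 / (4 * l t * l (t + 1))" for t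
    unfolding half_bessel_coeff_def l by simp
  note [simp] = add.assoc divide_simps nz nz0
  show "P t = B t - P (t + 1)"
    unfolding P B by (simp; unfold l; algebra)
  show "0 = half_bessel_coeff t - B t * P (t + 1) + A t + 0"
    unfolding P A B c by (simp; unfold l; algebra)
  show "0 = B t * 0 + A t * P (t + 2) - half_bessel_coeff (t + 1) * P (t + 1) - 0"
    unfolding P A B c by (simp; unfold l; algebra)
qed

text \<open>From k = 1 on the remainders are the bare series \<open>half_bessel k\<close>, and the
  contiguous relation is the recurrence itself. Only the initial remainder cos(x/2) - sin(x/2)
  differs, which accounts for the exceptional \<open>b 1\<close>.\<close>

lemma has_cfrac_shift_1:
  fixes a b :: "nat \<Rightarrow> rat fps"
  assumes b0: "b 0 = 0"
    and b1: "b 1 = 1 - fps_const (1 / 2) * fps_X"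
    and a: "\<And>k. k \<ge> 2 \<Longrightarrow> let t = rat_of_nat k in
           a k = fps_const (- 1 / ((4 * t - 6) * (4 * t - 2))) * fps_X ^ 2"
    and b: "\<And>k. k \<ge> 2 \<Longrightarrow> b k = 1"
    and f: "f * lincomb half_bessel fps_X (- (1 / 2)) 0 0 0 = a 1 * half_bessel 1"
  shows "has_cfrac f a b"
proof -
  have a': "a (Suc (Suc k)) = - (fps_const (half_bessel_coeff (of_nat k)) * fps_X ^ 2)" for k
  proof -
    define t :: rat where "t = of_nat k"
    have of_nat: "rat_of_nat (Suc (Suc k)) = t + 2" and ge: "Suc (Suc k) \<ge> 2"
      by (simp_all add: t_def)
    have "a (Suc (Suc k)) = fps_const (- half_bessel_coeff (of_nat k)) * fps_X ^ 2"
      unfolding a[OF ge, unfolded Let_def of_nat] half_bessel_coeff_def minus_divide_left t_def[symmetric]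
      by (rule fps_const_fraction_cong; (rule refl | algebra))
    then show ?thesis
      by (simp only: fps_const_neg[symmetric] mult_minus_left)
  qed
  show ?thesis
  proof (rule has_cfrac_of_recurrence[where a = a and b = b and f = f and
        h = "\<lambda>k. if k = 0 then lincomb half_bessel fps_X (- (1 / 2)) 0 0 0 else half_bessel k"])
    show "a k $ 0 = 0" if "k \<ge> 2" for k
      using a[OF that] by (simp add: Let_def power2_eq_square)
    show "b k $ 0 = 1" if "k \<ge> 1" for k
      using b[of k] b1 that by (cases "k = 1") simp_all
    show "(if k = 0 then lincomb half_bessel fps_X (- (1 / 2)) 0 0 0 else half_bessel k) =
        b (Suc k) * (if Suc k = 0 then lincomb half_bessel fps_X (- (1 / 2)) 0 0 0 else half_bessel (Suc k)) +
        a (Suc (Suc k)) * (if Suc (Suc k) = 0 then lincomb half_bessel fps_X (- (1 / 2)) 0 0 0 else half_bessel (Suc (Suc k)))" for k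
    proof (cases k)
      case 0
      have "b (Suc 0) = 1 + fps_const (- (1 / 2)) * fps_X"
        using b1 by (simp flip: fps_const_neg)
      then show ?thesis
        using half_bessel_rec[of 0] by (simp add: 0 lincomb_def a' algebra_simps)
    next
      case (Suc j)
      then show ?thesis
        using half_bessel_rec[of k] b[of "Suc k"] by (simp add: a' algebra_simps)
    qed
  qed (use b0 f in \<open>simp_all add: lincomb_nth_0\<close>)
qed

text \<open>Let F = tan x + sec x and F = 1 + x + x^2 G. From 1/F(x) = F(-x) = 1 - x + x^2 G(-x),
  the fraction of F is one initial step followed by the fraction of G with x replaced by -x; so the
  coefficient equations for G are reused at \<open>- fps_X\<close>.\<close>

lemma has_cfrac_shift_0:
  fixes a b :: "nat \<Rightarrow> rat fps"
  assumes b0: "b 0 = 0"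
    and b1: "b 1 = 1 - fps_X"
    and a2: "a 2 = fps_const (1 / 2) * fps_X ^ 2"
    and a: "\<And>k. k \<ge> 3 \<Longrightarrow> let t = rat_of_nat k in
           a k = fps_const (1 / (4 * t - 6) ^ 2) * fps_X ^ 2"
    and b: "\<And>k. k \<ge> 2 \<Longrightarrow> let t = rat_of_nat k in
           b k = 1 + fps_const ((- 1) ^ k * (2 * t - 2) / ((2 * t - 3) * (2 * t - 1))) * fps_X"
    and f: "f * lincomb half_bessel fps_X (- (1 / 2)) 0 0 0 = a 1 * lincomb half_bessel fps_X (1 / 2) 0 0 0"
  shows "has_cfrac f a b"
proof -
  define l P A B :: "rat \<Rightarrow> rat" where "l t = 2 * t + 1" and
    "P t = - 1 / (2 * l t)" and
    "A t = 1 / (4 * l (t + 1) ^ 2)" and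
    "B t = - (2 * (t + 1)) / (l t * l (t + 1))" for t
  note eqs = shift_2_coeff_eqs[of l P A B, OF l_def P_def A_def B_def]
  \<comment> \<open>Remainders of the tail: \<open>h 0\<close> is cos(x/2) + sin(x/2), the
    denominator with x replaced by -x. The initial remainder of the whole fraction is put in front
    by \<open>case_nat\<close> below.\<close>
  define h where "h k = lincomb half_bessel (- fps_X) ((- 1) ^ k * P (of_nat k)) 0 0 k" for k
  have h_0: "h 0 = lincomb half_bessel fps_X (1 / 2) 0 0 0"
    by (simp add: h_def P_def l_def lincomb_def flip: fps_const_neg)
  have h: "h k = (1 + fps_const ((- 1) ^ k * B (of_nat k)) * - fps_X) * h (Suc k) +
      fps_const (A (of_nat k)) * fps_X ^ 2 * h (Suc (Suc k))" for k
  proof -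
    have x: "(- fps_X) ^ 2 = (fps_X ^ 2 :: rat fps)"
      by simp
    show ?thesis
      using lincomb_alternating_rec[of half_bessel half_bessel_coeff "- fps_X" P B "\<lambda>_. 0" A "\<lambda>_. 0" k,
          unfolded x, OF half_bessel_rec eqs]
      unfolding h_def mult_zero_right by this simp_all
  qed
  have a': "a (Suc (Suc (Suc k))) = fps_const (A (of_nat k)) * fps_X ^ 2" for k
  proof -
    define t :: rat where "t = of_nat k"
    have of_nat: "rat_of_nat (Suc (Suc (Suc k))) = t + 3" and ge: "Suc (Suc (Suc k)) \<ge> 3"
      by (simp_all add: t_def)
    show ?thesis
      unfolding a[OF ge, unfolded Let_def of_nat] A_def t_def[symmetric] l_def
      by (rule fps_const_fraction_cong; (rule refl | algebra))
  qed
  have b': "b (Suc (Suc k)) = 1 + fps_const ((- 1) ^ k * B (of_nat k)) * - fps_X" for k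
  proof -
    define t e :: rat where "t = of_nat k" and "e = (- 1) ^ k"
    have of_nat: "rat_of_nat (Suc (Suc k)) = t + 2" and ge: "Suc (Suc k) \<ge> 2"
      by (simp_all add: t_def)
    have "b (Suc (Suc k)) = 1 - fps_const (e * B t) * fps_X"
      unfolding b[OF ge, unfolded Let_def of_nat] B_def l_def power_Suc e_def[symmetric] times_divide_eq_right
        diff_conv_add_uminus mult_minus_left[symmetric] fps_const_neg minus_divide_left
      by (rule fps_const_fraction_cong; (rule refl | algebra))
    then show ?thesis
      by (simp add: e_def t_def)
  qed
  show ?thesis
  proof (rule has_cfrac_of_recurrence[where a = a and b = b and f = f and
        h = "case_nat (lincomb half_bessel fps_X (- (1 / 2)) 0 0 0) h"])
    show "a k $ 0 = 0" if "k \<ge> 2" for k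
      using a[of k] a2 that by (cases "k = 2") (simp_all add: Let_def power2_eq_square)
    show "b k $ 0 = 1" if "k \<ge> 1" for k
      using b[of k] b1 that by (cases "k = 1") (simp_all add: Let_def)
    show "case_nat (lincomb half_bessel fps_X (- (1 / 2)) 0 0 0) h k $ 0 = 1" for k
      by (cases k) (simp_all add: h_def lincomb_nth_0)
    show "case_nat (lincomb half_bessel fps_X (- (1 / 2)) 0 0 0) h k =
        b (Suc k) * case_nat (lincomb half_bessel fps_X (- (1 / 2)) 0 0 0) h (Suc k) +
        a (Suc (Suc k)) * case_nat (lincomb half_bessel fps_X (- (1 / 2)) 0 0 0) h (Suc (Suc k))" for k
    proof (cases k)
      case 0
      have "lincomb half_bessel fps_X (- (1 / 2)) 0 0 0 = b 1 * h 0 + a 2 * h 1"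
      proof -
        \<comment> \<open>With the constants abstract and 1/12 = 1/2 * 1/6, the first step is a
          polynomial consequence of the contiguous relation and \<open>c + c = 1\<close>.\<close>
        define c d :: "rat fps" where "c = fps_const (1 / 2)" and "d = fps_const (1 / 6)"
        have c: "c + c = 1" and cd: "fps_const (1 / 12) = c * d"
          by (simp_all add: c_def d_def)
        have "half_bessel 0 = half_bessel 1 - c * d * (fps_X ^ 2 * half_bessel 2)"
          using half_bessel_rec[of 0] unfolding cd[symmetric] by (simp add: half_bessel_coeff_def numeral_2_eq_2)
        moreover have "lincomb half_bessel fps_X (- (1 / 2)) 0 0 0 = half_bessel 0 - c * (fps_X * half_bessel 1)"
          by (simp add: lincomb_def c_def flip: fps_const_neg)
        moreover have "h 0 = half_bessel 0 + c * (fps_X * half_bessel 1)"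
          by (simp add: h_0 lincomb_def c_def)
        moreover have "h 1 = half_bessel 1 - d * (fps_X * half_bessel 2)"
          by (simp add: h_def P_def l_def lincomb_def d_def numeral_2_eq_2)
        ultimately show ?thesis
          unfolding b1 a2 c_def[symmetric] using c by algebra
      qed
      then show ?thesis
        by (simp add: 0 numeral_2_eq_2)
    next
      case (Suc j)
      then show ?thesis
        using h[of j] by (simp add: a' b')
    qed
  qed (use b0 f in \<open>simp_all add: h_0\<close>)
qed

text \<open>Combinations of two consecutive series suffice here. \<open>P 0 = - 1 / 2\<close> makes
  the initial remainder the denominator cos(x/2) - sin(x/2), and \<open>- P 1 = 1 / 6\<close> gives
  the numerator.\<close>

lemma has_cfrac_shift_2:
  fixes a b :: "nat \<Rightarrow> rat fps"
  assumes b0: "b 0 = 0"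
    and a: "\<And>k. k \<ge> 2 \<Longrightarrow> let t = rat_of_nat k in
           a k = fps_const (1 / (4 * t - 2) ^ 2) * fps_X ^ 2"
    and b: "\<And>k. k \<ge> 1 \<Longrightarrow> let t = rat_of_nat k in
           b k = 1 + fps_const ((- 1) ^ k * (2 * t) / ((2 * t - 1) * (2 * t + 1))) * fps_X"
    and f: "f * lincomb half_bessel fps_X (- (1 / 2)) 0 0 0 = a 1 * lincomb half_bessel fps_X (1 / 6) 0 0 1"
  shows "has_cfrac f a b"
proof -
  define l P A B :: "rat \<Rightarrow> rat" where "l t = 2 * t + 1" and
    "P t = - 1 / (2 * l t)" and
    "A t = 1 / (4 * l (t + 1) ^ 2)" and
    "B t = - (2 * (t + 1)) / (l t * l (t + 1))" for t
  note eqs = shift_2_coeff_eqs[of l P A B, OF l_def P_def A_def B_def]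
  show ?thesis
  proof (rule has_cfrac_alternating[of b a A B P "\<lambda>_. 0" "\<lambda>_. 0"])
    fix k
    define t e :: rat where "t = of_nat k" and "e = (- 1) ^ k"
    have of_nat: "rat_of_nat (Suc (Suc k)) = t + 2" "rat_of_nat (Suc k) = t + 1" and ge: "Suc (Suc k) \<ge> 2" "Suc k \<ge> 1"
      by (simp_all add: t_def)
    show "a (Suc (Suc k)) = fps_const (A (of_nat k)) * fps_X ^ 2"
      unfolding a[OF ge(1), unfolded Let_def of_nat] A_def t_def[symmetric] l_def
      by (rule fps_const_fraction_cong; (rule refl | algebra))
    show "b (Suc k) = 1 + fps_const ((- 1) ^ k * B (of_nat k)) * fps_X"
      unfolding b[OF ge(2), unfolded Let_def of_nat] B_def t_def[symmetric] l_def power_Suc e_def[symmetric] times_divide_eq_right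
      by (rule fps_const_fraction_cong; (rule refl | algebra))
  qed (use b0 f eqs in \<open>simp_all add: P_def l_def\<close>)
qed

text \<open>
  Here and below, the coefficients \<open>P\<close>, \<open>Q\<close>, \<open>R\<close> of the combinations \<open>h\<^sub>k\<close> were obtained by computing the
  first few remainders and interpolating in \<open>k\<close>.
\<close>
lemma has_cfrac_shift_3:
  fixes a b :: "nat \<Rightarrow> rat fps"
  assumes b0: "b 0 = 0"
    and a: "\<And>j. j \<ge> 2 \<Longrightarrow> let t = rat_of_nat j in
           a j = fps_const (- ((t - 1) ^ 2 * (t + 1) ^ 2) / (4 * t ^ 4 * (2 * t - 1) * (2 * t + 1))) * fps_X ^ 2"
    and b: "\<And>j. j \<ge> 1 \<Longrightarrow> let t = rat_of_nat j in
           b j = 1 + fps_const ((- 1) ^ j * (2 * t ^ 2 + 2 * t + 1) / (2 * t ^ 2 * (t + 1) ^ 2)) * fps_X"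
    and f: "f * lincomb half_bessel fps_X (- (1 / 2)) 0 0 0 = a 1 * lincomb half_bessel fps_X (1 / 8) (1 / 240) 0 1"
  shows "has_cfrac f a b"
proof -
  define u l :: "rat \<Rightarrow> rat" where "u t = t + 1" and "l t = 2 * t + 1" for t
  have nz: "u t \<noteq> 0" "l t \<noteq> 0" if "t \<ge> 0" for t
    using that by (simp_all add: u_def l_def)
  \<comment> \<open>\<open>P 0 = - 1 / 2\<close> and \<open>Q 0 = 0\<close> reproduce the
    denominator at k = 0; \<open>- P 1\<close> and \<open>Q 1\<close> are the constants 1/8 and
    1/240 of the numerator.\<close>
  define P Q A B where
    "P t = - 1 / (2 * u t ^ 2)" and
    "Q t = t ^ 2 / (4 * u t ^ 2 * l t * l (t + 1))" and
    "A t = - ((t + 1) ^ 2 * (t + 3) ^ 2) / (4 * u (t + 1) ^ 4 * l (t + 1) * l (t + 2))" and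
    "B t = - (2 * (t + 1) ^ 2 + 2 * (t + 1) + 1) / (2 * u t ^ 2 * u (t + 1) ^ 2)" for t
  have c: "half_bessel_coeff t = 1 / (4 * l t * l (t + 1))" for t
    unfolding half_bessel_coeff_def l_def by simp
  show ?thesis
  proof (rule has_cfrac_alternating[of b a A B P Q "\<lambda>_. 0"])
    fix k
    define t e :: rat where "t = of_nat k" and "e = (- 1) ^ k"
    have of_nat: "rat_of_nat (Suc (Suc k)) = t + 2" "rat_of_nat (Suc k) = t + 1" and ge: "Suc (Suc k) \<ge> 2" "Suc k \<ge> 1"
      by (simp_all add: t_def)
    show "a (Suc (Suc k)) = fps_const (A (of_nat k)) * fps_X ^ 2"
      unfolding a[OF ge(1), unfolded Let_def of_nat] A_def t_def[symmetric] u_def l_def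
      by (rule fps_const_fraction_cong; (rule refl | algebra))
    show "b (Suc k) = 1 + fps_const ((- 1) ^ k * B (of_nat k)) * fps_X"
      unfolding b[OF ge(2), unfolded Let_def of_nat] B_def t_def[symmetric] u_def l_def power_Suc e_def[symmetric] times_divide_eq_right
      by (rule fps_const_fraction_cong; (rule refl | algebra))
  next
    fix t :: rat
    assume t: "t \<ge> 0"
    have nz': "u (t + s) \<noteq> 0" "l (t + s) \<noteq> 0" if "s \<ge> 0" for s
      using t that by (intro nz; simp)+
    note defs = P_def Q_def A_def B_def c
    note [simp] = add.assoc divide_simps nz' nz[OF t]
    show "P t = B t - P (t + 1)"
      unfolding defs by (simp; unfold u_def l_def; algebra)
    show "Q t = half_bessel_coeff t - B t * P (t + 1) + A t + Q (t + 1)"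
      unfolding defs by (simp; unfold u_def l_def; algebra)
    show "0 = B t * Q (t + 1) + A t * P (t + 2) - half_bessel_coeff (t + 1) * P (t + 1) - 0"
      unfolding defs by (simp; unfold u_def l_def; algebra)
    show "B t * 0 = A t * Q (t + 2) + half_bessel_coeff (t + 2) * Q (t + 1)"
      unfolding defs by (simp; unfold u_def l_def; algebra)
  qed (use b0 f in \<open>simp_all add: P_def Q_def u_def l_def\<close>)
qed

lemma has_cfrac_shift_4:
  fixes a b :: "nat \<Rightarrow> rat fps"
  assumes b0: "b 0 = 0"
    and a: "\<And>j. j \<ge> 2 \<Longrightarrow> let t = rat_of_nat j in
           a j = fps_const ((t ^ 2 + 3 * t + 1) * (t ^ 2 - t - 1) * (t + 2) * (t - 1)
              / (4 * (t ^ 2 + t - 1) ^ 2 * (2 * t + 1) ^ 2 * (t + 1) * t)) * fps_X ^ 2"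
    and b: "\<And>j. j \<ge> 1 \<Longrightarrow> let t = rat_of_nat j in
           b j = 1 + fps_const (2 * (- 1) ^ j * (t + 2) * (t + 1) ^ 3 * t
              / ((t ^ 2 + 3 * t + 1) * (t ^ 2 + t - 1) * (2 * t + 3) * (2 * t + 1))) * fps_X"
    and f: "f * lincomb half_bessel fps_X (- (1 / 2)) 0 0 0 =
      a 1 * lincomb half_bessel fps_X (7 / 50) (1 / 300) (1 / 21000) 1"
  shows "has_cfrac f a b"
proof -
  \<comment> \<open>The quadratic factors of the prescribed coefficients all become shifts of the
    single \<open>q\<close> (for instance t^2 + t - 1 at t + 1 is \<open>q t\<close>), so one
    nonvanishing fact serves for every quadratic denominator.\<close>
  define u l q :: "rat \<Rightarrow> rat" where "u t = t + 1" and "l t = 2 * t + 1" and "q t = t ^ 2 + 3 * t + 1" for t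
  have nz: "u t \<noteq> 0" "l t \<noteq> 0" "q t \<noteq> 0" if "t \<ge> 0" for t
    using that zero_le_power2[of t] by (simp_all add: u_def l_def q_def, linarith+)
  define P Q R A B where
    "P t = - (t ^ 2 + 3 * t + 3) / (2 * q t * l (t + 1))" and
    "Q t = t * (t ^ 2 + t + 1) / (4 * u (t + 1) * l t * l (t + 1) * q t)" and
    "R t = - (t * (t ^ 2 + t - 1)) / (8 * u (t + 1) * l (t + 1) ^ 2 * l (t + 2) * q t)" and
    "A t = q (t + 2) * q t * (t + 4) * (t + 1) / (4 * q (t + 1) ^ 2 * l (t + 2) ^ 2 * u (t + 2) * u (t + 1))" and
    "B t = - (2 * (t + 3) * (t + 2) ^ 3 * (t + 1)) / (q (t + 1) * q t * l (t + 2) * l (t + 1))" for t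
  have c: "half_bessel_coeff t = 1 / (4 * l t * l (t + 1))" for t
    unfolding half_bessel_coeff_def l_def by simp
  show ?thesis
  proof (rule has_cfrac_alternating[of b a A B P Q R])
    fix k
    define t e :: rat where "t = of_nat k" and "e = (- 1) ^ k"
    have of_nat: "rat_of_nat (Suc (Suc k)) = t + 2" "rat_of_nat (Suc k) = t + 1" and ge: "Suc (Suc k) \<ge> 2" "Suc k \<ge> 1"
      by (simp_all add: t_def)
    show "a (Suc (Suc k)) = fps_const (A (of_nat k)) * fps_X ^ 2"
      unfolding a[OF ge(1), unfolded Let_def of_nat] A_def t_def[symmetric] u_def l_def q_def
      by (rule fps_const_fraction_cong; (rule refl | algebra))
    show "b (Suc k) = 1 + fps_const ((- 1) ^ k * B (of_nat k)) * fps_X"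
      unfolding b[OF ge(2), unfolded Let_def of_nat] B_def t_def[symmetric] u_def l_def q_def power_Suc e_def[symmetric] times_divide_eq_right
      by (rule fps_const_fraction_cong; (rule refl | algebra))
  next
    fix t :: rat
    assume t: "t \<ge> 0"
    have nz': "u (t + s) \<noteq> 0" "l (t + s) \<noteq> 0" "q (t + s) \<noteq> 0" if "s \<ge> 0" for s
      using t that by (intro nz; simp)+
    note defs = P_def Q_def R_def A_def B_def c
    note [simp] = add.assoc divide_simps nz' nz[OF t]
    show "P t = B t - P (t + 1)"
      unfolding defs by (simp; unfold u_def l_def q_def; algebra)
    show "Q t = half_bessel_coeff t - B t * P (t + 1) + A t + Q (t + 1)"
      unfolding defs by (simp; unfold u_def l_def q_def; algebra)
    show "R t = B t * Q (t + 1) + A t * P (t + 2) - half_bessel_coeff (t + 1) * P (t + 1) - R (t + 1)"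
      unfolding defs by (simp; unfold u_def l_def q_def; algebra)
    show "B t * R (t + 1) = A t * Q (t + 2) + half_bessel_coeff (t + 2) * Q (t + 1)"
      unfolding defs by (simp; unfold u_def l_def q_def; algebra)
    show "A t * R (t + 2) = half_bessel_coeff (t + 3) * R (t + 1)"
      unfolding defs by (simp; unfold u_def l_def q_def; algebra)
  qed (use b0 f in \<open>simp_all add: P_def Q_def R_def u_def l_def q_def\<close>)
qed

section \<open>Shifts of the tangent series\<close>

text \<open>The argument stays a parameter because the tangent is treated both as a series in x^2
  and, after x^2 is replaced by x, as a series without gaps.\<close>

definition bessel_at :: "rat fps \<Rightarrow> nat \<Rightarrow> rat fps" where
  "bessel_at x m = bessel_half m oo x"

definition bessel_coeff :: "rat \<Rightarrow> rat" where
  "bessel_coeff t = 1 / ((2 * t + 1) * (2 * t + 3))"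

lemma bessel_at_nth_0 [simp]: "bessel_at x m $ 0 = 1"
  by (simp add: bessel_at_def)

lemma bessel_at_rec:
  assumes "x $ 0 = 0"
  shows "bessel_at x m = bessel_at x (Suc m) - fps_const (bessel_coeff (of_nat m)) * (x * bessel_at x (Suc (Suc m)))"
  unfolding bessel_at_def by (subst bessel_half_compose_rec[OF assms]) (simp add: bessel_coeff_def add.commute)

text \<open>\<open>m\<close> is the Bessel index at which the initial remainder starts: 0 for the
  even contraction, 1 and 2 for the further shifts. Partial denominators have the form 1 - \<beta>
  x, hence \<open>- \<beta>\<close> in the equations.\<close>

lemma has_cfrac_step_2:
  fixes p q \<alpha> \<beta> :: "rat \<Rightarrow> rat"
  assumes b0: "b 0 = 0"
    and x: "x $ 0 = 0"
    and a: "\<And>k. a (Suc (Suc k)) = fps_const (\<alpha> (of_nat k)) * x ^ 2"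
    and b: "\<And>k. b (Suc k) = 1 - fps_const (\<beta> (of_nat k)) * x"
    and eqs: "\<And>t. t \<ge> 0 \<Longrightarrow> p t = bessel_coeff (2 * t + s) + - \<beta> t + bessel_coeff (2 * t + s + 1) + p (t + 1)"
      "\<And>t. t \<ge> 0 \<Longrightarrow> q t = p t * bessel_coeff (2 * t + s + 1) + p (t + 1) * - \<beta> t + q (t + 1) + \<alpha> t +
        (bessel_coeff (2 * t + s + 1) + p (t + 1)) * bessel_coeff (2 * t + s + 2)"
      "\<And>t. t \<ge> 0 \<Longrightarrow> q t * bessel_coeff (2 * t + s + 2) + - \<beta> t * q (t + 1) + \<alpha> t * p (t + 2) +
        (q (t + 1) + \<alpha> t + (bessel_coeff (2 * t + s + 1) + p (t + 1)) * bessel_coeff (2 * t + s + 2)) *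
          bessel_coeff (2 * t + s + 3) = 0"
      "\<And>t. t \<ge> 0 \<Longrightarrow> \<alpha> t * q (t + 2) =
        (q t * bessel_coeff (2 * t + s + 2) + - \<beta> t * q (t + 1)) * bessel_coeff (2 * t + s + 4)"
    and s: "s = of_nat m"
    and f: "f * lincomb (bessel_at x) x (p 0) (q 0) 0 m = a 1 * lincomb (bessel_at x) x (p 1) (q 1) 0 (Suc (Suc m))"
  shows "has_cfrac f a b"
proof -
  define h where "h k = lincomb (bessel_at x) x (p (of_nat k)) (q (of_nat k)) 0 (2 * k + m)" for k
  show ?thesis
  proof (rule has_cfrac_of_recurrence[where a = a and b = b and f = f and h = h])
    show "a k $ 0 = 0" if "k \<ge> 2" for k
    proof -
      have k: "k = Suc (Suc (k - 2))"
        using that by simp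
      show ?thesis
        by (subst k, subst a) (simp add: power2_eq_square x)
    qed
    show "b k $ 0 = 1" if "k \<ge> 1" for k
      using b[of "k - 1"] that x by simp
    have rec: "h k = (1 + fps_const (- \<beta> (of_nat k)) * x) * h (Suc k) + fps_const (\<alpha> (of_nat k)) * x ^ 2 * h (Suc (Suc k))" for k
      unfolding h_def by (rule lincomb_step_2_rec[where \<beta> = "\<lambda>t. - \<beta> t", OF bessel_at_rec[OF x] eqs s])
    show "h k = b (Suc k) * h (Suc k) + a (Suc (Suc k)) * h (Suc (Suc k))" for k
      using rec[of k] unfolding a b by (simp flip: fps_const_neg)
  qed (use b0 f x in \<open>simp_all add: h_def lincomb_nth_0\<close>)
qed

text \<open>Eliminating the series of index j+1 and j+3 from three consecutive contiguous relations
  with coefficients c_j gives y_j = (1 - (c_j + c_{j+1}) x) y_{j+2} - c_{j+1} c_{j+2} x^2 y_{j+4};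
  \<open>B\<close> and \<open>A\<close> are these coefficients at j = 2t + s.\<close>

lemma contraction_coeff_eqs:
  fixes l A B :: "rat \<Rightarrow> rat"
  assumes l: "\<And>t. l t = 2 * t + 1"
    and A: "\<And>t. A t = - 1 / (l (2 * t + s + 1) * l (2 * t + s + 2) ^ 2 * l (2 * t + s + 3))"
    and B: "\<And>t. B t = 2 / (l (2 * t + s) * l (2 * t + s + 2))"
    and s: "s \<ge> 0" and t: "t \<ge> 0"
  shows "B t = bessel_coeff (2 * t + s) + bessel_coeff (2 * t + s + 1)"
    and "A t = - bessel_coeff (2 * t + s + 1) * bessel_coeff (2 * t + s + 2)"
proof -
  have nz: "l (2 * t + (s + r)) \<noteq> 0" "l (2 * t + s) \<noteq> 0" if "r \<ge> 0" for r
    using s t that by (simp_all add: l)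
  have c: "bessel_coeff t = 1 / (l t * l (t + 1))" for t
    unfolding bessel_coeff_def l by simp
  note [simp] = add.assoc divide_simps nz nz(2)[of 0]
  show "B t = bessel_coeff (2 * t + s) + bessel_coeff (2 * t + s + 1)"
    unfolding B c by (simp; unfold l; algebra)
  show "A t = - bessel_coeff (2 * t + s + 1) * bessel_coeff (2 * t + s + 2)"
    unfolding A c by (simp; unfold l; algebra)
qed

text \<open>The remainders are the bare series of even index 2k.\<close>

lemma has_cfrac_tan_even_contraction:
  fixes a b :: "nat \<Rightarrow> rat fps"
  assumes b0: "b 0 = 0" and x: "x $ 0 = 0"
    and a: "\<And>k. k \<ge> 2 \<Longrightarrow> let t = rat_of_nat k in
           a k = fps_const (- 1 / ((4 * t - 5) * (4 * t - 3) ^ 2 * (4 * t - 1))) * x ^ 2"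
    and b: "\<And>k. k \<ge> 1 \<Longrightarrow> let t = rat_of_nat k in
           b k = 1 - fps_const (2 / ((4 * t - 3) * (4 * t + 1))) * x"
    and f: "f * bessel_at x 0 = a 1 * bessel_at x 2"
  shows "has_cfrac f a b"
proof -
  define l A B :: "rat \<Rightarrow> rat" where "l t = 2 * t + 1" and
    "A t = - 1 / (l (2 * t + 0 + 1) * l (2 * t + 0 + 2) ^ 2 * l (2 * t + 0 + 3))" and
    "B t = 2 / (l (2 * t + 0) * l (2 * t + 0 + 2))" for t
  note eqs = contraction_coeff_eqs[of l A 0 B, OF l_def A_def B_def order_refl]
  show ?thesis
  proof (rule has_cfrac_step_2[of b x a A B "\<lambda>_. 0" 0 "\<lambda>_. 0" 0])
    fix k
    define t :: rat where "t = of_nat k"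
    have of_nat: "rat_of_nat (Suc (Suc k)) = t + 2" "rat_of_nat (Suc k) = t + 1" and ge: "Suc (Suc k) \<ge> 2" "Suc k \<ge> 1"
      by (simp_all add: t_def)
    show "a (Suc (Suc k)) = fps_const (A (of_nat k)) * x ^ 2"
      unfolding a[OF ge(1), unfolded Let_def of_nat] A_def t_def[symmetric] l_def
      by (rule fps_const_fraction_cong; (rule refl | algebra))
    show "b (Suc k) = 1 - fps_const (B (of_nat k)) * x"
      unfolding b[OF ge(2), unfolded Let_def of_nat] B_def t_def[symmetric] l_def
      by (rule fps_const_fraction_cong; (rule refl | algebra))
  qed (use b0 x f in \<open>simp_all add: eqs lincomb_def numeral_2_eq_2\<close>)
qed

text \<open>The remainders have indices 0, 1, 3, 5 and so on. After the first they are the odd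
  contraction; the first step raises the index by 1 only and is treated apart.\<close>

lemma has_cfrac_tan_odd_contraction:
  fixes a b :: "nat \<Rightarrow> rat fps"
  assumes b0: "b 0 = 0" and x: "x $ 0 = 0"
    and b1: "b 1 = 1 - fps_const (1 / 3) * x"
    and a: "\<And>k. k \<ge> 2 \<Longrightarrow> let t = rat_of_nat k in
           a k = fps_const (- 1 / ((4 * t - 7) * (4 * t - 5) ^ 2 * (4 * t - 3))) * x ^ 2"
    and b: "\<And>k. k \<ge> 2 \<Longrightarrow> let t = rat_of_nat k in
           b k = 1 - fps_const (2 / ((4 * t - 5) * (4 * t - 1))) * x"
    and f: "f * bessel_at x 0 = a 1 * bessel_at x 1"
  shows "has_cfrac f a b"
proof -
  define l A B :: "rat \<Rightarrow> rat" where "l t = 2 * t + 1" and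
    "A t = - 1 / (l (2 * t + 1 + 1) * l (2 * t + 1 + 2) ^ 2 * l (2 * t + 1 + 3))" and
    "B t = 2 / (l (2 * t + 1) * l (2 * t + 1 + 2))" for t
  note eqs = contraction_coeff_eqs[of l A 1 B, OF l_def A_def B_def zero_le_one]
  define h where "h k = bessel_at x (2 * k + 1)" for k
  have h: "h k = (1 + fps_const (- B (of_nat k)) * x) * h (Suc k) + fps_const (A (of_nat k)) * x ^ 2 * h (Suc (Suc k))" for k
  proof -
    have "lincomb (bessel_at x) x 0 0 0 (2 * k + 1) =
        (1 + fps_const (- B (of_nat k)) * x) * lincomb (bessel_at x) x 0 0 0 (2 * Suc k + 1) +
        fps_const (A (of_nat k)) * x ^ 2 * lincomb (bessel_at x) x 0 0 0 (2 * Suc (Suc k) + 1)"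
      by (rule lincomb_step_2_rec[where \<beta> = "\<lambda>t. - B t" and p = "\<lambda>_. 0" and q = "\<lambda>_. 0" and s = 1, OF bessel_at_rec[OF x]])
        (simp_all add: eqs)
    then show ?thesis
      by (simp add: lincomb_def h_def)
  qed
  have a': "a (Suc (Suc (Suc k))) = fps_const (A (of_nat k)) * x ^ 2" for k
  proof -
    define t :: rat where "t = of_nat k"
    have of_nat: "rat_of_nat (Suc (Suc (Suc k))) = t + 3" and ge: "Suc (Suc (Suc k)) \<ge> 2"
      by (simp_all add: t_def)
    show ?thesis
      unfolding a[OF ge, unfolded Let_def of_nat] A_def t_def[symmetric] l_def
      by (rule fps_const_fraction_cong; (rule refl | algebra))
  qed
  have b': "b (Suc (Suc k)) = 1 - fps_const (B (of_nat k)) * x" for k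
  proof -
    define t :: rat where "t = of_nat k"
    have of_nat: "rat_of_nat (Suc (Suc k)) = t + 2" and ge: "Suc (Suc k) \<ge> 2"
      by (simp_all add: t_def)
    show ?thesis
      unfolding b[OF ge, unfolded Let_def of_nat] B_def t_def[symmetric] l_def
      by (rule fps_const_fraction_cong; (rule refl | algebra))
  qed
  show ?thesis
  proof (rule has_cfrac_of_recurrence[where a = a and b = b and f = f and h = "case_nat (bessel_at x 0) h"])
    show "a k $ 0 = 0" if "k \<ge> 2" for k
      using a[of k] that x by (simp add: Let_def power2_eq_square)
    show "b k $ 0 = 1" if "k \<ge> 1" for k
      using b[of k] b1 that x by (cases "k = 1") (simp_all add: Let_def)
    show "case_nat (bessel_at x 0) h k $ 0 = 1" for k
      by (cases k) (simp_all add: h_def)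
    show "case_nat (bessel_at x 0) h k = b (Suc k) * case_nat (bessel_at x 0) h (Suc k) +
        a (Suc (Suc k)) * case_nat (bessel_at x 0) h (Suc (Suc k))" for k
    proof (cases k)
      case 0
      \<comment> \<open>Inserting y_2 = y_1 + x y_3 / 15 into y_0 = y_1 - x y_2 / 3 gives the first
        step; the 45 in \<open>a 2\<close> is 3 * 15.\<close>
      define c d :: "rat fps" where "c = fps_const (1 / 3)" and "d = fps_const (1 / 15)"
      have "fps_const (- 1 / 45) = - (c * d)"
        by (simp add: c_def d_def)
      then have "a (Suc (Suc 0)) = - (c * d) * x ^ 2"
        using a[of "Suc (Suc 0)"] by (simp add: Let_def)
      moreover have "b (Suc 0) = 1 - c * x"
        using b1 by (simp add: c_def)
      moreover have "bessel_at x 0 = bessel_at x 1 - c * (x * bessel_at x 2)"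
        "bessel_at x 1 = bessel_at x 2 - d * (x * bessel_at x 3)"
        using bessel_at_rec[OF x, of 0] bessel_at_rec[OF x, of 1]
        by (simp_all add: bessel_coeff_def c_def d_def numeral_2_eq_2 numeral_3_eq_3)
      ultimately have "bessel_at x 0 = b (Suc 0) * bessel_at x 1 + a (Suc (Suc 0)) * bessel_at x 3"
        by algebra
      then show ?thesis
        by (simp add: 0 h_def numeral_3_eq_3)
    next
      case (Suc j)
      then show ?thesis
        using h[of j] by (simp add: a' b' flip: fps_const_neg)
    qed
  qed (use b0 f in \<open>simp_all add: h_def\<close>)
qed

text \<open>The remainders combine the series of index 2k+1 and 2k+2. The one for k = 0 equals the
  denominator \<open>bessel_at fps_X 0\<close> by a single contiguous relation, as
  \<open>P 0 = - 1 / 3\<close>.\<close>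

lemma has_cfrac_tan_shift_2:
  fixes a b :: "nat \<Rightarrow> rat fps"
  assumes b0: "b 0 = 0"
    and a: "\<And>j. j \<ge> 2 \<Longrightarrow> let t = rat_of_nat j in
           a j = fps_const (- ((2 * t + 1) * (2 * t - 3) * (t + 1) * (t - 1))
              / ((4 * t + 1) * (4 * t - 1) ^ 2 * (4 * t - 3) * (2 * t - 1) ^ 2 * t ^ 2)) * fps_X ^ 2"
    and b: "\<And>j. j \<ge> 1 \<Longrightarrow> let t = rat_of_nat j in
           b j = 1 - fps_const ((8 * t ^ 4 + 8 * t ^ 3 + 22 * t ^ 2 + 10 * t + 3)
              / ((4 * t + 3) * (4 * t - 1) * (2 * t + 1) * (2 * t - 1) * (t + 1) * t)) * fps_X"
    and f: "f * bessel_at fps_X 0 = a 1 * lincomb (bessel_at fps_X) fps_X (- (1 / 42)) 0 0 3"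
  shows "has_cfrac f a b"
proof -
  define u l :: "rat \<Rightarrow> rat" where "u t = t + 1" and "l t = 2 * t + 1" for t
  have nz: "u t \<noteq> 0" "l t \<noteq> 0" if "t \<ge> 0" for t
    using that by (simp_all add: u_def l_def)
  define P A B where
    "P t = - 1 / (l (2 * t + 1) * u t * l t)" and
    "A t = - ((2 * t + 5) * (2 * t + 1) * (t + 3) * (t + 1)) /
      (l (2 * t + 4) * l (2 * t + 3) ^ 2 * l (2 * t + 2) * l (t + 1) ^ 2 * u (t + 1) ^ 2)" and
    "B t = (8 * (t + 1) ^ 4 + 8 * (t + 1) ^ 3 + 22 * (t + 1) ^ 2 + 10 * (t + 1) + 3) /
      (l (2 * t + 3) * l (2 * t + 1) * l (t + 1) * l t * u (t + 1) * u t)" for t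
  have c: "bessel_coeff t = 1 / (l t * l (t + 1))" for t
    unfolding bessel_coeff_def l_def by simp
  have base: "lincomb (bessel_at fps_X) fps_X (P 0) 0 0 1 = bessel_at fps_X 0"
    using bessel_at_rec[of fps_X 0] by (simp add: lincomb_def P_def l_def u_def bessel_coeff_def flip: fps_const_neg)
  show ?thesis
  proof (rule has_cfrac_step_2[of b fps_X a A B P 1 "\<lambda>_. 0" 1])
    fix k
    define t :: rat where "t = of_nat k"
    have of_nat: "rat_of_nat (Suc (Suc k)) = t + 2" "rat_of_nat (Suc k) = t + 1" and ge: "Suc (Suc k) \<ge> 2" "Suc k \<ge> 1"
      by (simp_all add: t_def)
    show "a (Suc (Suc k)) = fps_const (A (of_nat k)) * fps_X ^ 2"
      unfolding a[OF ge(1), unfolded Let_def of_nat] A_def t_def[symmetric] u_def l_def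
      by (rule fps_const_fraction_cong; (rule refl | algebra))
    show "b (Suc k) = 1 - fps_const (B (of_nat k)) * fps_X"
      unfolding b[OF ge(2), unfolded Let_def of_nat] B_def t_def[symmetric] u_def l_def
      by (rule fps_const_fraction_cong; (rule refl | algebra))
  next
    fix t :: rat
    assume t: "t \<ge> 0"
    have nz': "u (t + s) \<noteq> 0" "l (t + s) \<noteq> 0" "l (2 * t + s) \<noteq> 0" if "s \<ge> 0" for s
      using t that by (intro nz; simp)+
    note defs = P_def A_def B_def c
    note [simp] = add.assoc divide_simps nz' nz[OF t]
    \<comment> \<open>Brings shifted arguments into the form \<open>2 * t + s\<close>, for which the
      nonvanishing facts are stated.\<close>
    have arg: "2 * (t + 1) + s = 2 * t + (2 + s)" "2 * (t + 2) + s = 2 * t + (4 + s)" for s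
      by simp_all
    show "P t = bessel_coeff (2 * t + 1) + - B t + bessel_coeff (2 * t + 1 + 1) + P (t + 1)"
      unfolding defs arg by (simp; unfold u_def l_def; algebra)
    show "0 = P t * bessel_coeff (2 * t + 1 + 1) + P (t + 1) * - B t + 0 + A t +
        (bessel_coeff (2 * t + 1 + 1) + P (t + 1)) * bessel_coeff (2 * t + 1 + 2)"
      unfolding defs arg by (simp; unfold u_def l_def; algebra)
    show "0 * bessel_coeff (2 * t + 1 + 2) + - B t * 0 + A t * P (t + 2) +
        (0 + A t + (bessel_coeff (2 * t + 1 + 1) + P (t + 1)) * bessel_coeff (2 * t + 1 + 2)) *
          bessel_coeff (2 * t + 1 + 3) = 0"
      unfolding defs arg by (simp; unfold u_def l_def; algebra)
  qed (use b0 f base in \<open>simp_all add: P_def u_def l_def numeral_3_eq_3\<close>)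
qed

text \<open>Remainders start at index 2k+2 and have three terms.\<close>

lemma has_cfrac_tan_shift_3:
  fixes a b :: "nat \<Rightarrow> rat fps"
  assumes b0: "b 0 = 0"
    and a: "\<And>j. j \<ge> 2 \<Longrightarrow> let t = rat_of_nat j in
           a j = fps_const (- ((4 * t ^ 2 + 10 * t + 3) * (4 * t ^ 2 - 6 * t - 1) * (2 * t + 3) * (2 * t - 3) * (t + 2) * (t - 1))
              / ((4 * t ^ 2 + 2 * t - 3) ^ 2 * (4 * t + 3) * (4 * t + 1) ^ 2 * (4 * t - 1)
              * (2 * t + 1) * (2 * t - 1) * (t + 1) * t)) * fps_X ^ 2"
    and b: "\<And>j. j \<ge> 1 \<Longrightarrow> let t = rat_of_nat j in
           b j = 1 - fps_const (2 * (16 * t ^ 4 + 48 * t ^ 3 + 164 * t ^ 2 + 192 * t + 45)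
              / ((4 * t ^ 2 + 10 * t + 3) * (4 * t ^ 2 + 2 * t - 3) * (4 * t + 5) * (4 * t + 1))) * fps_X"
    and f: "f * bessel_at fps_X 0 = a 1 * lincomb (bessel_at fps_X) fps_X (- (2 / 51)) (2 / 8415) 0 4"
  shows "has_cfrac f a b"
proof -
  \<comment> \<open>The three quadratic factors are again shifts of one polynomial: 4t^2 + 2t - 3 at
    t + 1 and 4t^2 - 6t - 1 at t + 2 both equal \<open>v t\<close>.\<close>
  define u l v :: "rat \<Rightarrow> rat" where "u t = t + 1" and "l t = 2 * t + 1" and "v t = 4 * t ^ 2 + 10 * t + 3" for t
  have nz: "u t \<noteq> 0" "l t \<noteq> 0" "v t \<noteq> 0" if "t \<ge> 0" for t
    using that zero_le_power2[of t] by (simp_all add: u_def l_def v_def, linarith+)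
  define P Q A B where
    "P t = - 6 / (v t * l (2 * t + 2))" and
    "Q t = 6 / (v t * l (2 * t + 2) * l (2 * t + 3) * u (t + 1) * l (t + 1))" and
    "A t = - (v (t + 2) * v t * (2 * t + 7) * (2 * t + 1) * (t + 4) * (t + 1)) /
      (v (t + 1) ^ 2 * l (2 * t + 5) * l (2 * t + 4) ^ 2 * l (2 * t + 3) * l (t + 2) * l (t + 1) * u (t + 2) * u (t + 1))" and
    "B t = 2 * (16 * (t + 1) ^ 4 + 48 * (t + 1) ^ 3 + 164 * (t + 1) ^ 2 + 192 * (t + 1) + 45) /
      (v (t + 1) * v t * l (2 * t + 4) * l (2 * t + 2))" for t
  have c: "bessel_coeff t = 1 / (l t * l (t + 1))" for t
    unfolding bessel_coeff_def l_def by simp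
  \<comment> \<open>Rewriting the series of index 0 with three contiguous relations in terms of
    those of index 2, 3 and 4 gives the coefficients -(1/3 + 1/15) and 1/3 * 1/35, which are
    \<open>P 0\<close> and \<open>Q 0\<close>.\<close>
  have base: "lincomb (bessel_at fps_X) fps_X (P 0) (Q 0) 0 2 = bessel_at fps_X 0"
  proof -
    define c d :: "rat fps" where "c = fps_const (1 / 3)" and "d = fps_const (1 / 15)"
    have P: "fps_const (P 0) = - (c + d)"
      by (simp add: P_def v_def l_def c_def d_def)
    have e: "fps_const (1 / 35) * c = fps_const (Q 0)"
      by (simp add: Q_def u_def v_def l_def c_def)
    have "bessel_at fps_X 0 = bessel_at fps_X 1 - c * (fps_X * bessel_at fps_X 2)"
      "bessel_at fps_X 1 = bessel_at fps_X 2 - d * (fps_X * bessel_at fps_X 3)"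
      "bessel_at fps_X 2 = bessel_at fps_X 3 - fps_const (1 / 35) * (fps_X * bessel_at fps_X 4)"
      using bessel_at_rec[of fps_X 0] bessel_at_rec[of fps_X 1] bessel_at_rec[of fps_X 2]
      by (simp_all add: bessel_coeff_def c_def d_def eval_nat_numeral)
    moreover have "lincomb (bessel_at fps_X) fps_X (P 0) (Q 0) 0 2 =
        bessel_at fps_X 2 - (c + d) * (fps_X * bessel_at fps_X 3) + fps_const (1 / 35) * c * (fps_X ^ 2 * bessel_at fps_X 4)"
      unfolding lincomb_def P e by (simp add: eval_nat_numeral algebra_simps)
    ultimately show ?thesis
      by algebra
  qed
  show ?thesis
  proof (rule has_cfrac_step_2[of b fps_X a A B P 2 Q 2])
    fix k
    define t :: rat where "t = of_nat k"
    have of_nat: "rat_of_nat (Suc (Suc k)) = t + 2" "rat_of_nat (Suc k) = t + 1" and ge: "Suc (Suc k) \<ge> 2" "Suc k \<ge> 1"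
      by (simp_all add: t_def)
    show "a (Suc (Suc k)) = fps_const (A (of_nat k)) * fps_X ^ 2"
      unfolding a[OF ge(1), unfolded Let_def of_nat] A_def t_def[symmetric] u_def l_def v_def
      by (rule fps_const_fraction_cong; (rule refl | algebra))
    show "b (Suc k) = 1 - fps_const (B (of_nat k)) * fps_X"
      unfolding b[OF ge(2), unfolded Let_def of_nat] B_def t_def[symmetric] u_def l_def v_def
      by (rule fps_const_fraction_cong; (rule refl | algebra))
  next
    fix t :: rat
    assume t: "t \<ge> 0"
    have nz': "u (t + s) \<noteq> 0" "l (t + s) \<noteq> 0" "v (t + s) \<noteq> 0" "l (2 * t + s) \<noteq> 0" if "s \<ge> 0" for s
      using t that by (intro nz; simp)+
    note defs = P_def Q_def A_def B_def c
    note [simp] = add.assoc divide_simps nz' nz[OF t]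
    have arg: "2 * (t + 1) + s = 2 * t + (2 + s)" "2 * (t + 2) + s = 2 * t + (4 + s)" for s
      by simp_all
    show "P t = bessel_coeff (2 * t + 2) + - B t + bessel_coeff (2 * t + 2 + 1) + P (t + 1)"
      unfolding defs arg by (simp; unfold u_def l_def v_def; algebra)
    show "Q t = P t * bessel_coeff (2 * t + 2 + 1) + P (t + 1) * - B t + Q (t + 1) + A t +
        (bessel_coeff (2 * t + 2 + 1) + P (t + 1)) * bessel_coeff (2 * t + 2 + 2)"
      unfolding defs arg by (simp; unfold u_def l_def v_def; algebra)
    show "Q t * bessel_coeff (2 * t + 2 + 2) + - B t * Q (t + 1) + A t * P (t + 2) +
        (Q (t + 1) + A t + (bessel_coeff (2 * t + 2 + 1) + P (t + 1)) * bessel_coeff (2 * t + 2 + 2)) *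
          bessel_coeff (2 * t + 2 + 3) = 0"
      unfolding defs arg by (simp; unfold u_def l_def v_def; algebra)
    show "A t * Q (t + 2) = (Q t * bessel_coeff (2 * t + 2 + 2) + - B t * Q (t + 1)) * bessel_coeff (2 * t + 2 + 4)"
      unfolding defs arg by (simp; unfold u_def l_def v_def; algebra)
  qed (use b0 f base in \<open>simp_all add: P_def Q_def u_def l_def v_def eval_nat_numeral\<close>)
qed

text \<open>Lambert's fraction: the contiguous relation is the recurrence, with the bare series as
  remainders.\<close>

lemma has_cfrac_tan:
  fixes a b :: "nat \<Rightarrow> rat fps"
  assumes b0: "b 0 = 0"
    and a: "\<And>k. k \<ge> 2 \<Longrightarrow> let t = rat_of_nat k in
           a k = fps_const (- 1 / ((2 * t - 3) * (2 * t - 1))) * x"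
    and b: "\<And>k. k \<ge> 1 \<Longrightarrow> b k = 1"
    and x: "x $ 0 = 0"
    and f: "f * bessel_at x 0 = a 1 * bessel_at x 1"
  shows "has_cfrac f a b"
proof (rule has_cfrac_of_recurrence[where a = a and b = b and f = f and h = "bessel_at x"])
  show "a k $ 0 = 0" if "k \<ge> 2" for k
    using a[OF that] x by (simp add: Let_def)
  fix k
  define t :: rat where "t = of_nat k"
  have of_nat: "rat_of_nat (Suc (Suc k)) = t + 2" and ge: "Suc (Suc k) \<ge> 2"
    by (simp_all add: t_def)
  have "a (Suc (Suc k)) = fps_const (- bessel_coeff (of_nat k)) * x"
    unfolding a[OF ge, unfolded Let_def of_nat] bessel_coeff_def minus_divide_left t_def[symmetric]
    by (rule fps_const_fraction_cong; (rule refl | algebra))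
  then show "bessel_at x k = b (Suc k) * bessel_at x (Suc k) + a (Suc (Suc k)) * bessel_at x (Suc (Suc k))"
    using bessel_at_rec[OF x, of k] b[of "Suc k"] by (simp add: mult.assoc flip: fps_const_neg)
qed (use b0 b f in simp_all)

text \<open>Two earlier families interlace: the remainder for k = 2j has the coefficients of the
  j-th one in \<open>has_cfrac_tan_shift_2\<close>, and the one for k = 2j+1 is the bare series of
  index 2j+2, as in the even contraction.\<close>

lemma has_cfrac_tan_odd_shift_1:
  fixes a b :: "nat \<Rightarrow> rat fps"
  assumes b0: "b 0 = 0"
    and a_even: "\<And>k. k \<ge> 1 \<Longrightarrow> let t = rat_of_nat k in
           a (2 * k) = fps_const (- ((2 * t + 1) * (t + 1)) / ((4 * t - 1) * (4 * t + 1) * (2 * t - 1) * t)) * x"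
    and a_odd: "\<And>k. k \<ge> 1 \<Longrightarrow> let t = rat_of_nat k in
           a (2 * k + 1) = fps_const (- (t * (2 * t - 1)) / ((4 * t + 1) * (4 * t + 3) * (2 * t + 1) * (t + 1))) * x"
    and b: "\<And>k. k \<ge> 1 \<Longrightarrow> b k = 1"
    and x: "x $ 0 = 0"
    and f: "f * bessel_at x 0 = a 1 * bessel_at x 2"
  shows "has_cfrac f a b"
proof -
  define u l :: "rat \<Rightarrow> rat" where "u t = t + 1" and "l t = 2 * t + 1" for t
  have nz: "u t \<noteq> 0" "l t \<noteq> 0" if "t \<ge> 0" for t
    using that by (simp_all add: u_def l_def)
  have c: "bessel_coeff t = 1 / (l t * l (t + 1))" for t
    unfolding bessel_coeff_def l_def by simp
  define P A B where
    "P t = - 1 / (l (2 * t + 1) * u t * l t)" and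
    "A t = - (l (t + 1) * u (t + 1)) / (l (2 * t + 1) * l (2 * t + 2) * l t * u t)" and
    "B t = - (u t * l t) / (l (2 * t + 2) * l (2 * t + 3) * l (t + 1) * u (t + 1))" for t
  define p \<alpha> where "p k = (if even k then P (of_nat (k div 2)) else 0)" and
    "\<alpha> k = (if even k then A (of_nat (k div 2)) else B (of_nat (k div 2)))" for k :: nat
  \<comment> \<open>The conditions of \<open>lincomb_step_1_rec\<close> split by parity. For odd k
    the second one is void, since \<open>p\<close> vanishes at odd indices.\<close>
  have eqs: "P t = bessel_coeff (2 * t + 1) + A t" "0 = bessel_coeff (2 * t + 2) + P (t + 1) + B t"
    "P t * bessel_coeff (2 * t + 2) + A t * P (t + 1) = 0" if t: "t \<ge> 0" for t
  proof -
    have nz': "u (t + s) \<noteq> 0" "l (t + s) \<noteq> 0" "l (2 * t + s) \<noteq> 0" if "s \<ge> 0" for s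
      using t that by (intro nz; simp)+
    have arg: "2 * (t + 1) + s = 2 * t + (2 + s)" for s
      by simp
    note [simp] = add.assoc divide_simps nz' nz[OF t]
    show "P t = bessel_coeff (2 * t + 1) + A t"
      unfolding P_def A_def B_def c arg by (simp; unfold u_def l_def; algebra)
    show "0 = bessel_coeff (2 * t + 2) + P (t + 1) + B t"
      unfolding P_def A_def B_def c arg by (simp; unfold u_def l_def; algebra)
    show "P t * bessel_coeff (2 * t + 2) + A t * P (t + 1) = 0"
      unfolding P_def A_def B_def c arg by (simp; unfold u_def l_def; algebra)
  qed
  have a: "a (Suc (Suc k)) = fps_const (\<alpha> k) * x" for k
  proof -
    define j where "j = k div 2"
    define t :: rat where "t = of_nat j"
    have of_nat: "rat_of_nat (Suc j) = t + 1" and ge: "Suc j \<ge> 1"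
      by (simp_all add: t_def)
    show ?thesis
    proof (cases "even k")
      case True
      then have k: "Suc (Suc k) = 2 * Suc j"
        by (simp add: j_def)
      have "a (Suc (Suc k)) = fps_const (A t) * x"
        unfolding k a_even[OF ge, unfolded Let_def of_nat] A_def u_def l_def
        by (rule fps_const_fraction_cong; (rule refl | algebra))
      then show ?thesis
        using True by (simp add: \<alpha>_def j_def t_def)
    next
      case False
      then have k: "Suc (Suc k) = 2 * Suc j + 1"
        by (simp add: j_def)
      have "a (Suc (Suc k)) = fps_const (B t) * x"
        unfolding k a_odd[OF ge, unfolded Let_def of_nat] B_def u_def l_def
        by (rule fps_const_fraction_cong; (rule refl | algebra))
      then show ?thesis
        using False by (simp add: \<alpha>_def j_def t_def)
    qed
  qed
  define h where "h k = lincomb (bessel_at x) x (p k) 0 0 (Suc k)" for k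
  have h: "h k = h (Suc k) + fps_const (\<alpha> k) * x * h (Suc (Suc k))" for k
  proof -
    define j where "j = k div 2"
    define t :: rat where "t = of_nat j"
    have t: "t \<ge> 0"
      by (simp add: t_def)
    have "p k = bessel_coeff (of_nat (Suc k)) + p (Suc k) + \<alpha> k \<and>
        p k * bessel_coeff (of_nat (Suc (Suc k))) + \<alpha> k * p (Suc (Suc k)) = 0"
    proof (cases "even k")
      case True
      then have k: "k = 2 * j"
        by (simp add: j_def)
      have "rat_of_nat (Suc k) = 2 * t + 1" "rat_of_nat (Suc (Suc k)) = 2 * t + 2" "rat_of_nat (Suc (Suc k) div 2) = t + 1"
        by (simp_all add: k t_def)
      then show ?thesis
        using eqs[OF t] True by (simp only: p_def \<alpha>_def) (simp add: t_def j_def)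
    next
      case False
      then have k: "k = 2 * j + 1"
        by (simp add: j_def)
      have "rat_of_nat (Suc k) = 2 * t + 2" "rat_of_nat (Suc k div 2) = t + 1"
        by (simp_all add: k t_def)
      then show ?thesis
        using eqs[OF t] False by (simp only: p_def \<alpha>_def) (simp add: t_def j_def)
    qed
    then show ?thesis
      unfolding h_def by (intro lincomb_step_1_rec[where c = "\<lambda>k. bessel_coeff (of_nat k)", OF bessel_at_rec[OF x]]) auto
  qed
  have h_0: "h 0 = bessel_at x 0"
    using bessel_at_rec[OF x, of 0]
    by (simp add: h_def lincomb_def p_def P_def l_def u_def bessel_coeff_def flip: fps_const_neg)
  show ?thesis
  proof (rule has_cfrac_of_recurrence[where a = a and b = b and f = f and h = h])
    show "a k $ 0 = 0" if "k \<ge> 2" for k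
    proof -
      have k: "k = Suc (Suc (k - 2))"
        using that by simp
      show ?thesis
        by (subst k, subst a) (simp add: x)
    qed
    show "h k = b (Suc k) * h (Suc k) + a (Suc (Suc k)) * h (Suc (Suc k))" for k
      using h[of k] by (simp add: a b)
    show "f * h 0 = a 1 * h 1"
      using f unfolding h_0 by (simp add: h_def p_def lincomb_def numeral_2_eq_2)
  qed (use b0 b x in \<open>simp_all add: h_def lincomb_nth_0\<close>)
qed

section \<open>Identification of the series\<close>

text \<open>Used repeatedly to find the numerators of successive shifts over a fixed denominator.
  Comparing constant terms forces \<open>c\<close> to be the constant term of \<open>f\<close>,
  after which a factor \<open>fps_X\<close> cancels.\<close>

lemma fps_shift_mult_eq:
  fixes f D N N' :: "'a::field fps"
  assumes f: "f * D = N" and D: "D $ 0 \<noteq> 0"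
    and N: "N = fps_const c * D + fps_X * N'"
  shows "fps_shift 1 f * D = N'"
proof -
  have "f $ 0 * D $ 0 = c * D $ 0"
    using arg_cong[OF f, of "\<lambda>g. g $ 0"] unfolding N by simp
  then have "f = fps_const c + fps_X * fps_shift 1 f"
    using D by (intro fps_ext) simp
  then have "fps_X * (fps_shift 1 f * D) = fps_X * N'"
    using f unfolding N by (metis add_left_cancel distrib_right mult.assoc)
  then show ?thesis
    by simp
qed

lemma fps_shift_1_shift: "fps_shift 1 (fps_shift n f) = fps_shift (n + 1) f"
  using fps_shift_fps_shift[of 1 n f] by (simp add: add.commute)

text \<open>
  Identities between combinations of the series \<open>y m\<close> are verified coefficientwise: in terms of these
  opaque numbers they are linear consequences of the contiguous relations.
\<close>
definition shifted_nth :: "(nat \<Rightarrow> 'a::field fps) \<Rightarrow> 'a fps \<Rightarrow> nat \<Rightarrow> nat \<Rightarrow> nat \<Rightarrow> 'a" where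
  "shifted_nth y x n i m = (x ^ i * y m) $ n"

lemma lincomb_mult_nth:
  "(fps_const c * lincomb y x p q r m) $ n = c * (shifted_nth y x n 0 m + p * shifted_nth y x n 1 (m + 1) +
     q * shifted_nth y x n 2 (m + 2) + r * shifted_nth y x n 3 (m + 3))"
  "(x * (fps_const c * lincomb y x p q r m)) $ n = c * (shifted_nth y x n 1 m + p * shifted_nth y x n 2 (m + 1) +
     q * shifted_nth y x n 3 (m + 2) + r * shifted_nth y x n 4 (m + 3))"
proof -
  have "x * lincomb y x p q r m = x ^ 1 * y m + fps_const p * (x ^ 2 * y (m + 1)) +
     fps_const q * (x ^ 3 * y (m + 2)) + fps_const r * (x ^ 4 * y (m + 3))"
    by (simp add: lincomb_def eval_nat_numeral algebra_simps)
  then show "(x * (fps_const c * lincomb y x p q r m)) $ n = c * (shifted_nth y x n 1 m + p * shifted_nth y x n 2 (m + 1) +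
     q * shifted_nth y x n 3 (m + 2) + r * shifted_nth y x n 4 (m + 3))"
    by (simp add: shifted_nth_def mult.left_commute[of x])
qed (simp add: shifted_nth_def lincomb_def eval_nat_numeral)

lemma shifted_nth_half_bessel:
  "shifted_nth half_bessel fps_X n i m = shifted_nth half_bessel fps_X n i (m + 1) -
     half_bessel_coeff (of_nat m) * shifted_nth half_bessel fps_X n (i + 2) (m + 2)"
proof -
  have *: "fps_X ^ i * half_bessel m = fps_X ^ i * half_bessel (Suc m) -
      fps_const (half_bessel_coeff (of_nat m)) * (fps_X ^ (i + 2) * half_bessel (Suc (Suc m)))"
    by (subst half_bessel_rec) (simp add: eval_nat_numeral algebra_simps)
  show ?thesis
    unfolding shifted_nth_def * by simp
qed

lemma shifted_nth_bessel_at: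
  "shifted_nth (bessel_at fps_X) fps_X n i m = shifted_nth (bessel_at fps_X) fps_X n i (m + 1) -
     bessel_coeff (of_nat m) * shifted_nth (bessel_at fps_X) fps_X n (i + 1) (m + 2)"
proof -
  have *: "fps_X ^ i * bessel_at fps_X m = fps_X ^ i * bessel_at fps_X (Suc m) -
      fps_const (bessel_coeff (of_nat m)) * (fps_X ^ (i + 1) * bessel_at fps_X (Suc (Suc m)))"
    by (subst bessel_at_rec) (simp_all add: algebra_simps)
  show ?thesis
    unfolding shifted_nth_def * by simp
qed

text \<open>The constants split off are e_0 to e_3, and those in front of the new numerators are e_1
  to e_4. The last three numerators carry the combinations required at k = 1 by
  \<open>has_cfrac_shift_2\<close> to \<open>has_cfrac_shift_4\<close>.\<close>

lemma half_bessel_shift_eqs: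
  fixes D :: "rat fps"
  defines "D \<equiv> lincomb half_bessel fps_X (- (1 / 2)) 0 0 0"
  shows "fps_const 1 * lincomb half_bessel fps_X (1 / 2) 0 0 0 =
      fps_const 1 * D + fps_X * (fps_const 1 * lincomb half_bessel fps_X 0 0 0 1)"
    and "fps_const 1 * lincomb half_bessel fps_X 0 0 0 1 =
      fps_const 1 * D + fps_X * (fps_const (1 / 2) * lincomb half_bessel fps_X (1 / 6) 0 0 1)"
    and "fps_const (1 / 2) * lincomb half_bessel fps_X (1 / 6) 0 0 1 =
      fps_const (1 / 2) * D + fps_X * (fps_const (1 / 3) * lincomb half_bessel fps_X (1 / 8) (1 / 240) 0 1)"
    and "fps_const (1 / 3) * lincomb half_bessel fps_X (1 / 8) (1 / 240) 0 1 =
      fps_const (1 / 3) * D + fps_X * (fps_const (5 / 24) * lincomb half_bessel fps_X (7 / 50) (1 / 300) (1 / 21000) 1)"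
  \<comment> \<open>Rules that would break up products with constants or with \<open>fps_X\<close>
    are disabled, so that \<open>lincomb_mult_nth\<close> applies; then three contiguous relations
    finish by linear arithmetic in the opaque numbers.\<close>
  by (rule fps_ext;
      use shifted_nth_half_bessel[of _ 0 0] shifted_nth_half_bessel[of _ 1 1] shifted_nth_half_bessel[of _ 2 2] in
      \<open>simp add: D_def lincomb_mult_nth half_bessel_coeff_def eval_nat_numeral del: fps_mult_left_const_nth fps_X_mult_nth fps_const_1_eq_1\<close>; simp add: field_simps)+

lemma bessel_at_shift_eqs:
  shows "fps_const 1 * lincomb (bessel_at fps_X) fps_X 0 0 0 1 =
      fps_const 1 * lincomb (bessel_at fps_X) fps_X 0 0 0 0 + fps_X * (fps_const (1 / 3) * lincomb (bessel_at fps_X) fps_X 0 0 0 2)"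
    and "fps_const (1 / 3) * lincomb (bessel_at fps_X) fps_X 0 0 0 2 =
      fps_const (1 / 3) * lincomb (bessel_at fps_X) fps_X 0 0 0 0 +
      fps_X * (fps_const (2 / 15) * lincomb (bessel_at fps_X) fps_X (- (1 / 42)) 0 0 3)"
    and "fps_const (2 / 15) * lincomb (bessel_at fps_X) fps_X (- (1 / 42)) 0 0 3 =
      fps_const (2 / 15) * lincomb (bessel_at fps_X) fps_X 0 0 0 0 +
      fps_X * (fps_const (17 / 315) * lincomb (bessel_at fps_X) fps_X (- (2 / 51)) (2 / 8415) 0 4)"
  by (rule fps_ext;
      use shifted_nth_bessel_at[of _ 0 0] shifted_nth_bessel_at[of _ 0 1] shifted_nth_bessel_at[of _ 0 2] shifted_nth_bessel_at[of _ 1 2]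
        shifted_nth_bessel_at[of _ 1 3] shifted_nth_bessel_at[of _ 2 4] in
      \<open>simp add: lincomb_mult_nth bessel_coeff_def eval_nat_numeral del: fps_mult_left_const_nth fps_X_mult_nth fps_const_1_eq_1\<close>; simp add: field_simps)+

section \<open>The half-angle quotient for tan x + sec x\<close>

lemma sin_cos_half_bessel:
  "fps_cos (1 / 2) = half_bessel 0" "fps_sin (1 / 2) = fps_const (1 / 2) * (fps_X * half_bessel 1)"
  by (simp_all add: fps_cos_bessel fps_sin_bessel half_bessel_def power2_eq_square)

text \<open>With c = cos(x/2) and s = sin(x/2), cos x = (c - s)(c + s) and 1 + sin x = (c + s)^2;
  the factor c + s cancels because its constant term is 1.\<close>

lemma tan_plus_sec_half_bessel:
  "(fps_tan 1 + fps_sec 1) * lincomb half_bessel fps_X (- (1 / 2)) 0 0 0 = lincomb half_bessel fps_X (1 / 2) 0 0 0"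
proof -
  define s c :: "rat fps" where "s = fps_sin (1 / 2)" and "c = fps_cos (1 / 2)"
  have half: "(1 / 2 + 1 / 2 :: rat) = 1"
    by simp
  have cos: "fps_cos 1 = c * c - s * s" and sin: "fps_sin 1 = s * c + c * s"
    using fps_cos_add[of "1 / 2 :: rat" "1 / 2"] fps_sin_add[of "1 / 2 :: rat" "1 / 2"]
    unfolding half by (simp_all add: s_def c_def)
  have one: "c ^ 2 + s ^ 2 = 1"
    unfolding s_def c_def by (rule fps_sin_cos_sum_of_squares)
  have "(fps_tan 1 + fps_sec 1) * fps_cos 1 = (fps_sin 1 + 1 :: rat fps)"
    by (simp add: fps_tan_def fps_sec_def distrib_right inverse_mult_eq_1)
  then have "(fps_tan 1 + fps_sec 1) * (c - s) * (c + s) = (c + s) * (c + s)"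
    using one unfolding cos sin by algebra
  moreover have "(c + s) $ 0 \<noteq> 0"
    by (simp add: c_def s_def)
  ultimately have "(fps_tan 1 + fps_sec 1) * (c - s) = c + s"
    by (metis fps_zero_nth mult_right_cancel)
  moreover have "lincomb half_bessel fps_X (- (1 / 2)) 0 0 0 = c - s" "lincomb half_bessel fps_X (1 / 2) 0 0 0 = c + s"
    unfolding c_def s_def sin_cos_half_bessel by (simp_all add: lincomb_def flip: fps_const_neg)
  ultimately show ?thesis
    by simp
qed

section \<open>Euler numbers as coefficients of tangent and secant\<close>

lemma euler_e_eq: "euler_e n = (fps_tan 1 + fps_sec 1) $ n"
  by (simp add: euler_e_def euler_number_def)

text \<open>The series T with tan x = x T(x^2); its n-th coefficient is e_{2n+1}.\<close>

definition tan_series :: "rat fps" where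
  "tan_series = bessel_half 1 * inverse (bessel_half 0)"

lemma fps_tan_tan_series: "fps_tan 1 = fps_X * (tan_series oo fps_X ^ 2)"
  using fps_cos_bessel[of "1 :: rat"] fps_sin_bessel[of "1 :: rat"]
  by (simp add: fps_tan_def tan_series_def fps_divide_unit fps_compose_mult_distrib fps_inverse_compose mult.assoc)

text \<open>Shows the secant to be even, so that the odd-indexed e_n come from the tangent
  alone.\<close>

lemma fps_sec_bessel: "fps_sec (1 :: rat) = inverse (bessel_half 0) oo fps_X ^ 2"
  using fps_cos_bessel[of "1 :: rat"] by (simp add: fps_sec_def fps_inverse_compose)

lemma fps_compose_X_power2_nth:
  "((f :: rat fps) oo fps_X ^ 2) $ n = (if even n then f $ (n div 2) else 0)"
  using fps_compose_const_X_power2_nth[of f 1 n] by simp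

lemma euler_e_odd: "euler_e (2 * n + 1) = tan_series $ n"
  by (simp add: euler_e_eq fps_tan_tan_series fps_sec_bessel fps_compose_X_power2_nth)

lemma fps_tan_nth: "fps_tan 1 $ n = (if odd n then euler_e n else 0)"
  by (cases n) (auto simp: euler_e_eq fps_tan_tan_series fps_sec_bessel fps_compose_X_power2_nth)

lemma tan_series_mult: "tan_series * bessel_at fps_X 0 = bessel_at fps_X 1"
  by (simp add: tan_series_def bessel_at_def mult.assoc inverse_mult_eq_1)

lemma fps_tan_mult: "fps_tan 1 * bessel_at (fps_X ^ 2) 0 = fps_X * bessel_at (fps_X ^ 2) 1"
  using arg_cong[OF tan_series_mult, of "\<lambda>f. f oo fps_X ^ 2"]
  by (simp add: fps_tan_tan_series fps_compose_mult_distrib bessel_at_def mult.assoc)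

lemma Abs_fps_euler_e: "Abs_fps (\<lambda>n. euler_e (n + k)) = fps_shift k (fps_tan 1 + fps_sec 1)"
  by (simp add: fps_shift_def euler_e_eq)

lemma Abs_fps_euler_e_odd: "Abs_fps (\<lambda>n. euler_e (2 * n + (2 * k + 1))) = fps_shift k tan_series"
proof (rule fps_ext)
  show "Abs_fps (\<lambda>n. euler_e (2 * n + (2 * k + 1))) $ n = fps_shift k tan_series $ n" for n
    using euler_e_odd[of "n + k"] by (simp add: algebra_simps)
qed

lemma Abs_fps_tan: "Abs_fps (\<lambda>m. if odd (m + k) then euler_e (m + k) else 0) = fps_shift k (fps_tan 1)"
  by (rule fps_ext) (simp add: fps_tan_nth)

section \<open>Numerators of the shifted series over a common denominator\<close>

lemma half_bessel_numerators:
  defines "D \<equiv> lincomb half_bessel fps_X (- (1 / 2)) 0 0 0"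
  shows "fps_shift 1 (fps_tan 1 + fps_sec 1) * D = half_bessel 1"
    and "fps_shift 2 (fps_tan 1 + fps_sec 1) * D = fps_const (1 / 2) * lincomb half_bessel fps_X (1 / 6) 0 0 1"
    and "fps_shift 3 (fps_tan 1 + fps_sec 1) * D = fps_const (1 / 3) * lincomb half_bessel fps_X (1 / 8) (1 / 240) 0 1"
    and "fps_shift 4 (fps_tan 1 + fps_sec 1) * D =
      fps_const (5 / 24) * lincomb half_bessel fps_X (7 / 50) (1 / 300) (1 / 21000) 1"
proof -
  have D: "D $ 0 \<noteq> 0"
    by (simp add: D_def lincomb_nth_0)
  note eqs = half_bessel_shift_eqs[folded D_def]
  have "(fps_tan 1 + fps_sec 1) * D = fps_const 1 * lincomb half_bessel fps_X (1 / 2) 0 0 0"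
    unfolding D_def tan_plus_sec_half_bessel by simp
  note 1 = fps_shift_mult_eq[OF this D eqs(1)]
  note 2 = fps_shift_mult_eq[OF 1 D eqs(2), unfolded fps_shift_1_shift]
  note 3 = fps_shift_mult_eq[OF 2 D eqs(3), unfolded fps_shift_1_shift]
  note 4 = fps_shift_mult_eq[OF 3 D eqs(4), unfolded fps_shift_1_shift]
  show "fps_shift 1 (fps_tan 1 + fps_sec 1) * D = half_bessel 1"
    using 1 by (simp add: lincomb_def)
  show "fps_shift 2 (fps_tan 1 + fps_sec 1) * D = fps_const (1 / 2) * lincomb half_bessel fps_X (1 / 6) 0 0 1"
    using 2 by (simp add: numeral_2_eq_2)
  show "fps_shift 3 (fps_tan 1 + fps_sec 1) * D = fps_const (1 / 3) * lincomb half_bessel fps_X (1 / 8) (1 / 240) 0 1"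
    using 3 by (simp add: eval_nat_numeral)
  show "fps_shift 4 (fps_tan 1 + fps_sec 1) * D =
      fps_const (5 / 24) * lincomb half_bessel fps_X (7 / 50) (1 / 300) (1 / 21000) 1"
    using 4 by (simp add: eval_nat_numeral)
qed

lemma tan_series_numerators:
  "fps_shift 1 tan_series * bessel_at fps_X 0 = fps_const (1 / 3) * bessel_at fps_X 2"
  "fps_shift 2 tan_series * bessel_at fps_X 0 = fps_const (2 / 15) * lincomb (bessel_at fps_X) fps_X (- (1 / 42)) 0 0 3"
  "fps_shift 3 tan_series * bessel_at fps_X 0 =
    fps_const (17 / 315) * lincomb (bessel_at fps_X) fps_X (- (2 / 51)) (2 / 8415) 0 4"
proof -
  have L: "lincomb (bessel_at fps_X) fps_X 0 0 0 m = bessel_at fps_X m" for m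
    by (simp add: lincomb_def)
  have D: "bessel_at fps_X 0 $ 0 \<noteq> 0"
    by simp
  note eqs = bessel_at_shift_eqs[unfolded L]
  have "tan_series * bessel_at fps_X 0 = fps_const 1 * bessel_at fps_X 1"
    unfolding tan_series_mult by simp
  note 1 = fps_shift_mult_eq[OF this D eqs(1)]
  note 2 = fps_shift_mult_eq[OF 1 D eqs(2), unfolded fps_shift_1_shift]
  note 3 = fps_shift_mult_eq[OF 2 D eqs(3), unfolded fps_shift_1_shift]
  show "fps_shift 1 tan_series * bessel_at fps_X 0 = fps_const (1 / 3) * bessel_at fps_X 2"
    by (rule 1)
  show "fps_shift 2 tan_series * bessel_at fps_X 0 = fps_const (2 / 15) * lincomb (bessel_at fps_X) fps_X (- (1 / 42)) 0 0 3"
    using 2 by (simp add: numeral_2_eq_2)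
  show "fps_shift 3 tan_series * bessel_at fps_X 0 =
    fps_const (17 / 315) * lincomb (bessel_at fps_X) fps_X (- (2 / 51)) (2 / 8415) 0 4"
    using 3 by (simp add: eval_nat_numeral)
qed

text \<open>As every second coefficient of the tangent vanishes, steps with constant 0, which only
  cancel a factor x, alternate with a step that uses the contiguous relation.\<close>

lemma fps_tan_numerators:
  "fps_shift 1 (fps_tan 1) * bessel_at (fps_X ^ 2) 0 = bessel_at (fps_X ^ 2) 1"
  "fps_shift 2 (fps_tan 1) * bessel_at (fps_X ^ 2) 0 = fps_const (1 / 3) * fps_X * bessel_at (fps_X ^ 2) 2"
  "fps_shift 3 (fps_tan 1) * bessel_at (fps_X ^ 2) 0 = fps_const (1 / 3) * bessel_at (fps_X ^ 2) 2"
proof -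
  have D: "bessel_at (fps_X ^ 2) 0 $ 0 \<noteq> 0"
    by simp
  show 1: "fps_shift 1 (fps_tan 1) * bessel_at (fps_X ^ 2) 0 = bessel_at (fps_X ^ 2) 1"
    by (rule fps_shift_mult_eq[OF fps_tan_mult D, where c = 0]) simp
  have "bessel_at (fps_X ^ 2) 1 = fps_const 1 * bessel_at (fps_X ^ 2) 0 +
      fps_X * (fps_const (1 / 3) * fps_X * bessel_at (fps_X ^ 2) 2)"
    using bessel_at_rec[of "fps_X ^ 2" 0] by (simp add: bessel_coeff_def numeral_2_eq_2 algebra_simps)
  note 2 = fps_shift_mult_eq[OF 1 D this, unfolded fps_shift_1_shift]
  then show "fps_shift 2 (fps_tan 1) * bessel_at (fps_X ^ 2) 0 = fps_const (1 / 3) * fps_X * bessel_at (fps_X ^ 2) 2"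
    by (simp add: numeral_2_eq_2)
  have "fps_const (1 / 3) * fps_X * bessel_at (fps_X ^ 2) 2 = fps_const 0 * bessel_at (fps_X ^ 2) 0 +
      fps_X * (fps_const (1 / 3) * bessel_at (fps_X ^ 2) 2)"
    by (simp add: algebra_simps)
  note 3 = fps_shift_mult_eq[OF 2 D this, unfolded fps_shift_1_shift]
  then show "fps_shift 3 (fps_tan 1) * bessel_at (fps_X ^ 2) 0 = fps_const (1 / 3) * bessel_at (fps_X ^ 2) 2"
    by (simp add: eval_nat_numeral)
qed

section \<open>The thirteen continued fractions\<close>

theorem theorem6p2:
  shows "
    (\<forall>a b :: nat \<Rightarrow> rat fps.
       b 0 = 0 \<and>
       a 1 = 1 \<and>
       (\<forall>k\<ge>2. let t = rat_of_nat k in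
           a k = fps_const (- 1 / ((2 * t - 3) * (2 * t - 1))) * fps_X ^ 2) \<and>
       (\<forall>k\<ge>1. b k = 1)
       \<longrightarrow> has_cfrac (Abs_fps (\<lambda>m. if even m then euler_e (m + 1) else 0)) a b) \<and>
    (\<forall>a b :: nat \<Rightarrow> rat fps.
       b 0 = 0 \<and>
       a 1 = 1 \<and>
       b 1 = 1 - fps_const (1 / 3) * fps_X \<and>
       (\<forall>k\<ge>2. let t = rat_of_nat k in
           a k = fps_const (- 1 / ((4 * t - 7) * (4 * t - 5) ^ 2 * (4 * t - 3))) * fps_X ^ 2) \<and>
       (\<forall>k\<ge>2. let t = rat_of_nat k in
           b k = 1 - fps_const (2 / ((4 * t - 5) * (4 * t - 1))) * fps_X)
       \<longrightarrow> has_cfrac (Abs_fps (\<lambda>n. euler_e (2 * n + 1))) a b) \<and>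
    (\<forall>a b :: nat \<Rightarrow> rat fps.
       b 0 = 0 \<and>
       a 1 = fps_const (1 / 3) * fps_X \<and>
       (\<forall>k\<ge>2. let t = rat_of_nat k in
           a k = fps_const (- 1 / ((4 * t - 5) * (4 * t - 3) ^ 2 * (4 * t - 1))) * fps_X ^ 4) \<and>
       (\<forall>k\<ge>1. let t = rat_of_nat k in
           b k = 1 - fps_const (2 / ((4 * t - 3) * (4 * t + 1))) * fps_X ^ 2)
       \<longrightarrow> has_cfrac (Abs_fps (\<lambda>m. if odd m then euler_e (m + 2) else 0)) a b) \<and>
    (\<forall>a b :: nat \<Rightarrow> rat fps.
       b 0 = 0 \<and>
       a 1 = fps_X \<and>
       b 1 = 1 - fps_const (1 / 3) * fps_X ^ 2 \<and>
       (\<forall>k\<ge>2. let t = rat_of_nat k in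
           a k = fps_const (- 1 / ((4 * t - 7) * (4 * t - 5) ^ 2 * (4 * t - 3))) * fps_X ^ 4) \<and>
       (\<forall>k\<ge>2. let t = rat_of_nat k in
           b k = 1 - fps_const (2 / ((4 * t - 5) * (4 * t - 1))) * fps_X ^ 2)
       \<longrightarrow> has_cfrac (fps_tan 1) a b) \<and>
    (\<forall>a b :: nat \<Rightarrow> rat fps.
       b 0 = 0 \<and>
       a 1 = 1 \<and>
       b 1 = 1 - fps_const (1 / 2) * fps_X \<and>
       (\<forall>k\<ge>2. let t = rat_of_nat k in
           a k = fps_const (- 1 / ((4 * t - 6) * (4 * t - 2))) * fps_X ^ 2) \<and>
       (\<forall>k\<ge>2. b k = 1)
       \<longrightarrow> has_cfrac (Abs_fps (\<lambda>n. euler_e (n + 1))) a b) \<and>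
    (\<forall>a b :: nat \<Rightarrow> rat fps.
       b 0 = 0 \<and>
       a 1 = 1 \<and>
       b 1 = 1 - fps_X \<and>
       a 2 = fps_const (1 / 2) * fps_X ^ 2 \<and>
       (\<forall>k\<ge>3. let t = rat_of_nat k in
           a k = fps_const (1 / (4 * t - 6) ^ 2) * fps_X ^ 2) \<and>
       (\<forall>k\<ge>2. let t = rat_of_nat k in
           b k = 1 + fps_const ((- 1) ^ k * (2 * t - 2) / ((2 * t - 3) * (2 * t - 1))) * fps_X)
       \<longrightarrow> has_cfrac (fps_tan 1 + fps_sec 1) a b) \<and>
    (\<forall>a b :: nat \<Rightarrow> rat fps.
       b 0 = 0 \<and>
       a 1 = fps_const (1 / 2) \<and>
       (\<forall>k\<ge>2. let t = rat_of_nat k in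
           a k = fps_const (1 / (4 * t - 2) ^ 2) * fps_X ^ 2) \<and>
       (\<forall>k\<ge>1. let t = rat_of_nat k in
           b k = 1 + fps_const ((- 1) ^ k * (2 * t) / ((2 * t - 1) * (2 * t + 1))) * fps_X)
       \<longrightarrow> has_cfrac (Abs_fps (\<lambda>n. euler_e (n + 2))) a b) \<and>
    (\<forall>a b :: nat \<Rightarrow> rat fps.
       b 0 = 0 \<and>
       a 1 = fps_const (1 / 3) \<and>
       (\<forall>j\<ge>2. let t = rat_of_nat j in
           a j = fps_const (- ((t - 1) ^ 2 * (t + 1) ^ 2) / (4 * t ^ 4 * (2 * t - 1) * (2 * t + 1))) * fps_X ^ 2) \<and>
       (\<forall>j\<ge>1. let t = rat_of_nat j in
           b j = 1 + fps_const ((- 1) ^ j * (2 * t ^ 2 + 2 * t + 1) / (2 * t ^ 2 * (t + 1) ^ 2)) * fps_X)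
       \<longrightarrow> has_cfrac (Abs_fps (\<lambda>n. euler_e (n + 3))) a b) \<and>
    (\<forall>a b :: nat \<Rightarrow> rat fps.
       b 0 = 0 \<and>
       a 1 = fps_const (5 / 24) \<and>
       (\<forall>j\<ge>2. let t = rat_of_nat j in
           a j = fps_const ((t ^ 2 + 3 * t + 1) * (t ^ 2 - t - 1) * (t + 2) * (t - 1)
              / (4 * (t ^ 2 + t - 1) ^ 2 * (2 * t + 1) ^ 2 * (t + 1) * t)) * fps_X ^ 2) \<and>
       (\<forall>j\<ge>1. let t = rat_of_nat j in
           b j = 1 + fps_const (2 * (- 1) ^ j * (t + 2) * (t + 1) ^ 3 * t
              / ((t ^ 2 + 3 * t + 1) * (t ^ 2 + t - 1) * (2 * t + 3) * (2 * t + 1))) * fps_X)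
       \<longrightarrow> has_cfrac (Abs_fps (\<lambda>n. euler_e (n + 4))) a b) \<and>
    (\<forall>a b :: nat \<Rightarrow> rat fps.
       b 0 = 0 \<and>
       a 1 = fps_const (1 / 3) \<and>
       (\<forall>k\<ge>1. let t = rat_of_nat k in
           a (2 * k) = fps_const (- ((2 * t + 1) * (t + 1)) / ((4 * t - 1) * (4 * t + 1) * (2 * t - 1) * t)) * fps_X ^ 2) \<and>
       (\<forall>k\<ge>1. let t = rat_of_nat k in
           a (2 * k + 1) = fps_const (- (t * (2 * t - 1)) / ((4 * t + 1) * (4 * t + 3) * (2 * t + 1) * (t + 1))) * fps_X ^ 2) \<and>
       (\<forall>k\<ge>1. b k = 1)
       \<longrightarrow> has_cfrac (Abs_fps (\<lambda>m. if even m then euler_e (m + 3) else 0)) a b) \<and>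
    (\<forall>a b :: nat \<Rightarrow> rat fps.
       b 0 = 0 \<and>
       a 1 = fps_const (1 / 3) \<and>
       (\<forall>k\<ge>2. let t = rat_of_nat k in
           a k = fps_const (- 1 / ((4 * t - 5) * (4 * t - 3) ^ 2 * (4 * t - 1))) * fps_X ^ 2) \<and>
       (\<forall>k\<ge>1. let t = rat_of_nat k in
           b k = 1 - fps_const (2 / ((4 * t - 3) * (4 * t + 1))) * fps_X)
       \<longrightarrow> has_cfrac (Abs_fps (\<lambda>n. euler_e (2 * n + 3))) a b) \<and>
    (\<forall>a b :: nat \<Rightarrow> rat fps.
       b 0 = 0 \<and>
       a 1 = fps_const (2 / 15) \<and>
       (\<forall>j\<ge>2. let t = rat_of_nat j in
           a j = fps_const (- ((2 * t + 1) * (2 * t - 3) * (t + 1) * (t - 1))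
              / ((4 * t + 1) * (4 * t - 1) ^ 2 * (4 * t - 3) * (2 * t - 1) ^ 2 * t ^ 2)) * fps_X ^ 2) \<and>
       (\<forall>j\<ge>1. let t = rat_of_nat j in
           b j = 1 - fps_const ((8 * t ^ 4 + 8 * t ^ 3 + 22 * t ^ 2 + 10 * t + 3)
              / ((4 * t + 3) * (4 * t - 1) * (2 * t + 1) * (2 * t - 1) * (t + 1) * t)) * fps_X)
       \<longrightarrow> has_cfrac (Abs_fps (\<lambda>n. euler_e (2 * n + 5))) a b) \<and>
    (\<forall>a b :: nat \<Rightarrow> rat fps.
       b 0 = 0 \<and>
       a 1 = fps_const (17 / 315) \<and>
       (\<forall>j\<ge>2. let t = rat_of_nat j in
           a j = fps_const (- ((4 * t ^ 2 + 10 * t + 3) * (4 * t ^ 2 - 6 * t - 1) * (2 * t + 3) * (2 * t - 3) * (t + 2) * (t - 1))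
              / ((4 * t ^ 2 + 2 * t - 3) ^ 2 * (4 * t + 3) * (4 * t + 1) ^ 2 * (4 * t - 1)
              * (2 * t + 1) * (2 * t - 1) * (t + 1) * t)) * fps_X ^ 2) \<and>
       (\<forall>j\<ge>1. let t = rat_of_nat j in
           b j = 1 - fps_const (2 * (16 * t ^ 4 + 48 * t ^ 3 + 164 * t ^ 2 + 192 * t + 45)
              / ((4 * t ^ 2 + 10 * t + 3) * (4 * t ^ 2 + 2 * t - 3) * (4 * t + 5) * (4 * t + 1))) * fps_X)
       \<longrightarrow> has_cfrac (Abs_fps (\<lambda>n. euler_e (2 * n + 7))) a b)"
\<comment> \<open>Each case identifies its series as \<open>fps_tan 1 + fps_sec 1\<close>,
  \<open>fps_tan 1\<close> or \<open>tan_series\<close>, possibly shifted, and inserts the numerator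
  found above. In the tangent cases the argument is \<open>fps_X ^ 2\<close> for series with gaps
  and \<open>fps_X\<close> for those without.\<close>
proof (intro conjI allI impI, goal_cases)
  case (1 a b)
  have "Abs_fps (\<lambda>m. if even m then euler_e (m + 1) else 0) = fps_shift 1 (fps_tan 1)"
    using Abs_fps_tan[of 1] by simp
  then show ?case
    using 1 fps_tan_numerators(1) by (intro has_cfrac_tan[where x = "fps_X ^ 2"]) (simp_all add: Let_def)
next
  case (2 a b)
  have "Abs_fps (\<lambda>n. euler_e (2 * n + 1)) = tan_series"
    using Abs_fps_euler_e_odd[of 0] by simp
  then show ?case
    using 2 tan_series_mult by (intro has_cfrac_tan_odd_contraction[where x = fps_X]) (simp_all add: Let_def)
next
  case (3 a b)
  have "Abs_fps (\<lambda>m. if odd m then euler_e (m + 2) else 0) = fps_shift 2 (fps_tan 1)"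
    using Abs_fps_tan[of 2] by simp
  then show ?case
    using 3 fps_tan_numerators(2)
    by (intro has_cfrac_tan_even_contraction[where x = "fps_X ^ 2"]) (simp_all add: Let_def flip: power_mult)
next
  case (4 a b)
  then show ?case
    using fps_tan_mult
    by (intro has_cfrac_tan_odd_contraction[where x = "fps_X ^ 2"]) (simp_all add: Let_def flip: power_mult)
next
  case (5 a b)
  then show ?case
    using half_bessel_numerators(1) Abs_fps_euler_e[of 1] by (intro has_cfrac_shift_1) (simp_all add: Let_def)
next
  case (6 a b)
  then show ?case
    using tan_plus_sec_half_bessel by (intro has_cfrac_shift_0) (simp_all add: Let_def)
next
  case (7 a b)
  then show ?case
    using half_bessel_numerators(2) Abs_fps_euler_e[of 2] by (intro has_cfrac_shift_2) (simp_all add: Let_def)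
next
  case (8 a b)
  then show ?case
    using half_bessel_numerators(3) Abs_fps_euler_e[of 3] by (intro has_cfrac_shift_3) (simp_all add: Let_def)
next
  case (9 a b)
  then show ?case
    using half_bessel_numerators(4) Abs_fps_euler_e[of 4] by (intro has_cfrac_shift_4) (simp_all add: Let_def)
next
  case (10 a b)
  have "Abs_fps (\<lambda>m. if even m then euler_e (m + 3) else 0) = fps_shift 3 (fps_tan 1)"
    using Abs_fps_tan[of 3] by simp
  then show ?case
    using 10 fps_tan_numerators(3) by (intro has_cfrac_tan_odd_shift_1[where x = "fps_X ^ 2"]) (simp_all add: Let_def)
next
  case (11 a b)
  have "Abs_fps (\<lambda>n. euler_e (2 * n + 3)) = fps_shift 1 tan_series"
    using Abs_fps_euler_e_odd[of 1] by simp
  then show ?case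
    using 11 tan_series_numerators(1) by (intro has_cfrac_tan_even_contraction[where x = fps_X]) (simp_all add: Let_def)
next
  case (12 a b)
  have "Abs_fps (\<lambda>n. euler_e (2 * n + 5)) = fps_shift 2 tan_series"
    using Abs_fps_euler_e_odd[of 2] by simp
  then show ?case
    using 12 tan_series_numerators(2) by (intro has_cfrac_tan_shift_2) (simp_all add: Let_def)
next
  case (13 a b)
  have "Abs_fps (\<lambda>n. euler_e (2 * n + 7)) = fps_shift 3 tan_series"
    using Abs_fps_euler_e_odd[of 3] by simp
  then show ?case
    using 13 tan_series_numerators(3) by (intro has_cfrac_tan_shift_3) (simp_all add: Let_def)
qed

end
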